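(* Let $\alpha>0$ and $\varepsilon_\alpha:=\frac{1}{4\alpha^2}$. There exists $\delta>0$ such that for all $\varepsilon\in(\varepsilon_\alpha-\delta,\varepsilon_\alpha+\delta)$ the boundary value problem $$\frac{1}{u\sqrt{1+u'^2}}\frac{d}{dx}\Bigl(\frac{u}{\sqrt{1+u'^2}}H'\Bigr)+\frac12 H\Bigl(\frac{u''}{(1+u'^2)^{3/2}}+\frac{1}{u\sqrt{1+u'^2}}\Bigr)^2-2\varepsilon H=0 \ \text{ in } (-1,1),\qquad u(\pm1)=\alpha,\ u'(\pm1)=0,$$ has a smooth family (in $\varepsilon$) of solutions $u_\varepsilon\in N_\alpha\cap C^\infty([-1,1])$.
   Context: Here, for a positive $C^2$ function $u$ on $[-1,1]$, $H(x):=\frac12\Bigl(\frac{1}{u(x)\sqrt{1+u'(x)^2}}-\frac{u''(x)}{(1+u'(x)^2)^{3/2}}\Bigr)$ is the mean curvature of the surface of revolution generated by $u$. For $\alpha>0$, $N_\alpha:=\{u\in H^2(-1,1): u \text{ even},\ u>0 \text{ on } [-1,1],\ u(\pm1)=\alpha,\ u'(\pm1)=0\}$. *)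

theory Defs
  imports "HOL-Analysis.Analysis"
begin

text \<open>Mean curvature of the surface of revolution generated by u (interior points).\<close>
definition mean_curv :: "(real \<Rightarrow> real) \<Rightarrow> real \<Rightarrow> real" where
  "mean_curv u x = 1/2 * (1 / (u x * sqrt (1 + (deriv u x)^2))
      - deriv (deriv u) x / (sqrt (1 + (deriv u x)^2))^3)"

definition helfrich_eq :: "real \<Rightarrow> (real \<Rightarrow> real) \<Rightarrow> real \<Rightarrow> bool" where
  "helfrich_eq \<epsilon> u x \<longleftrightarrow>
     (1 / (u x * sqrt (1 + (deriv u x)^2)))
        * deriv (\<lambda>y. u y / sqrt (1 + (deriv u y)^2) * deriv (mean_curv u) y) x
     + 1/2 * mean_curv u x * (deriv (deriv u) x / (sqrt (1 + (deriv u x)^2))^3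
                              + 1 / (u x * sqrt (1 + (deriv u x)^2)))^2
     - 2 * \<epsilon> * mean_curv u x = 0"

text \<open>Membership in N_alpha (evenness, positivity, boundary conditions; one-sided
  derivative at the endpoints). The H^2 requirement is implied by smoothness below.\<close>
definition in_N :: "real \<Rightarrow> (real \<Rightarrow> real) \<Rightarrow> bool" where
  "in_N \<alpha> u \<longleftrightarrow> (\<forall>x\<in>{-1..1}. u (-x) = u x) \<and> (\<forall>x\<in>{-1..1}. u x > 0)
     \<and> u (-1) = \<alpha> \<and> u 1 = \<alpha>
     \<and> (u has_real_derivative 0) (at (-1) within {-1..1})
     \<and> (u has_real_derivative 0) (at 1 within {-1..1})"

definition Cinf_on :: "real set \<Rightarrow> (real \<Rightarrow> real) \<Rightarrow> bool" where
  "Cinf_on J u \<longleftrightarrow> (\<exists>D::nat \<Rightarrow> real \<Rightarrow> real. D 0 = u \<and>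
     (\<forall>n. \<forall>x\<in>J. (D n has_real_derivative D (Suc n) x) (at x within J)))"

definition smooth_family_on :: "real set \<Rightarrow> real set \<Rightarrow> (real \<Rightarrow> real \<Rightarrow> real) \<Rightarrow> bool" where
  "smooth_family_on I J U \<longleftrightarrow> (\<exists>D::nat \<Rightarrow> nat \<Rightarrow> real \<Rightarrow> real \<Rightarrow> real. D 0 0 = U \<and>
     (\<forall>i j. continuous_on (I \<times> J) (\<lambda>(e, x). D i j e x) \<and>
        (\<forall>e\<in>I. \<forall>x\<in>J.
           ((\<lambda>e'. D i j e' x) has_real_derivative D (Suc i) j e x) (at e within I) \<and>
           ((\<lambda>x'. D i j e x') has_real_derivative D i (Suc j) e x) (at x within J))))"

end

theory Submission
  imports Defs "HOL-Complex_Analysis.Complex_Analysis"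
begin

text \<open>
  At \<open>\<epsilon> = 1/(4\<alpha>\<^sup>2)\<close> the cylinder \<open>u = \<alpha>\<close> is a solution, and there the linearised equation is
  \<open>v'''' + v/\<alpha>\<^sup>4 = 0\<close> with clamped boundary conditions, which has only the trivial solution.
  Inverting this linear operator turns the problem into a fixed point equation \<open>f = N(\<epsilon>, G f)\<close> for
  \<open>f = v'''' + v/\<alpha>\<^sup>4\<close> in which \<open>N\<close> has no first-order part in \<open>v\<close>, hence a contraction.
  Both \<open>\<epsilon>\<close> and \<open>x\<close> are taken complex: the iterates are holomorphic in each variable, and so is their
  uniform limit, which makes the solution smooth in \<open>(\<epsilon>, x)\<close> jointly without any differentiation of the
  fixed point equation. Evenness and realness are preserved by the iteration.
\<close>

section \<open>Separately holomorphic functions of two variables\<close>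

text \<open>The critical \<open>\<epsilon>\<close> is where the constant curvature
  \<open>H = 1/(2 \<alpha>)\<close> of the cylinder solves
  \<open>H/(2 \<alpha>^2) = 2 \<epsilon> H\<close>. At that value the first-order contributions of
  \<open>u''\<close> cancel too, which leaves \<open>- v/\<alpha>^4\<close> alone. The inverse G of
  the clamped operator is explicit, built from the four roots of \<open>l^4 = - 4 k^4\<close> with
  \<open>4 k^4 = 1/\<alpha>^4\<close>; evenness reduces the boundary conditions to the two at 1, and
  their determinant is a multiple of \<open>cos k sin k + cosh k sinh k > 0\<close>. Taking f rather
  than v as the unknown avoids a loss of derivatives: N involves v up to third order, and G f with
  its first three derivatives is bounded by the sup norm of f. So sup norms over the complex disc of
  radius 2 suffice; this disc is an open neighbourhood of [-1, 1], stable under negation and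
  conjugation. The small Lipschitz constant of N comes from strict differentiability, which compares
  two nearby points; the part of the derivative that survives acts on \<open>\<epsilon>\<close>
  alone and drops out when both points share \<open>\<epsilon>\<close>.\<close>

definition sep_holomorphic :: "(complex \<Rightarrow> complex \<Rightarrow> complex) \<Rightarrow> complex set \<Rightarrow> complex set \<Rightarrow> bool" where
  "sep_holomorphic h S T \<longleftrightarrow> continuous_on (S \<times> T) (\<lambda>(e, x). h e x) \<and>
     (\<forall>x\<in>T. (\<lambda>e. h e x) holomorphic_on S) \<and> (\<forall>e\<in>S. h e holomorphic_on T)"

lemma sep_holomorphicD:
  assumes "sep_holomorphic h S T"
  shows "continuous_on (S \<times> T) (\<lambda>(e, x). h e x)"
    and "x \<in> T \<Longrightarrow> (\<lambda>e. h e x) holomorphic_on S"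
    and "e \<in> S \<Longrightarrow> h e holomorphic_on T"
  using assms by (auto simp: sep_holomorphic_def)

lemma sep_holomorphic_swap:
  assumes "sep_holomorphic h S T"
  shows "sep_holomorphic (\<lambda>x e. h e x) T S"
proof -
  have "continuous_on (T \<times> S) (\<lambda>q. (\<lambda>(e, x). h e x) (snd q, fst q))"
    by (rule continuous_on_compose2[OF sep_holomorphicD(1)[OF assms]]) (auto intro!: continuous_intros)
  then show ?thesis
    using assms by (auto simp: sep_holomorphic_def case_prod_unfold)
qed

text \<open>Cauchy's formula for the first derivative, with the factor 2 pi i cancelled against the
  velocity of the circle. The domain of integration depends neither on \<open>x\<close> nor on
  parameters of \<open>f\<close>, so dependence on them can be read off the integrand.\<close>

lemma deriv_eq_circle_mean:
  assumes "f holomorphic_on T" "cball x r \<subseteq> T" "0 < r"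
  shows "deriv f x = integral (cbox 0 1)
    (\<lambda>t::real. f (x + of_real r * exp (2 * of_real pi * \<i> * of_real t)) * exp (- (2 * of_real pi * \<i> * of_real t)) / of_real r)"
proof -
  have hol: "f holomorphic_on cball x r"
    using assms holomorphic_on_subset by blast
  have "contour_integral (circlepath x r) (\<lambda>u. f u / (u - x)^2) = 2 * of_real pi * \<i> * deriv f x"
    using Cauchy_contour_integral_circlepath[of x r f x 1] hol holomorphic_on_subset[OF hol ball_subset_cball] assms(3)
    by (simp add: holomorphic_on_imp_continuous_on power2_eq_square)
  moreover have "contour_integral (circlepath x r) (\<lambda>u. f u / (u - x)^2)
      = integral {0..1} (\<lambda>t. 2 * of_real pi * \<i> * (f (x + of_real r * exp (2 * of_real pi * \<i> * of_real t)) *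
          exp (- (2 * of_real pi * \<i> * of_real t)) / of_real r))"
    unfolding contour_integral_integral
  proof (rule integral_cong)
    fix t :: real
    have "circlepath x r t = x + of_real r * exp (2 * of_real pi * \<i> * of_real t)"
      by (simp add: circlepath)
    then show "f (circlepath x r t) / (circlepath x r t - x)\<^sup>2 * vector_derivative (circlepath x r) (at t) =
        2 * of_real pi * \<i> * (f (x + of_real r * exp (2 * of_real pi * \<i> * of_real t)) *
          exp (- (2 * of_real pi * \<i> * of_real t)) / of_real r)"
      using assms(3) by (simp add: vector_derivative_circlepath power2_eq_square exp_minus field_simps)
  qed
  ultimately have "2 * of_real pi * \<i> * deriv f x = 2 * of_real pi * \<i> * integral {0..1}
      (\<lambda>t. f (x + of_real r * exp (2 * of_real pi * \<i> * of_real t)) *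
          exp (- (2 * of_real pi * \<i> * of_real t)) / of_real r)"
    by (simp only: integral_mult_right)
  then show ?thesis
    by (simp del: integral_divide)
qed

lemma continuous_on_circle_integrand:
  fixes h :: "complex \<Rightarrow> complex \<Rightarrow> complex"
  assumes "continuous_on (S \<times> T) (\<lambda>(e, x). h e x)" "A \<subseteq> S \<times> T"
    and "\<And>e x y. (e, x) \<in> A \<Longrightarrow> dist x y \<le> r \<Longrightarrow> y \<in> T" and "0 < r"
  shows "continuous_on (A \<times> cbox 0 1) (\<lambda>(p, t::real). h (fst p)
    (snd p + of_real r * exp (2 * of_real pi * \<i> * of_real t)) * exp (- (2 * of_real pi * \<i> * of_real t)) / of_real r)"
proof -
  have "continuous_on (A \<times> cbox 0 1) (\<lambda>q::(complex \<times> complex) \<times> real. (\<lambda>(e, x). h e x)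
     (fst (fst q), snd (fst q) + of_real r * exp (2 * of_real pi * \<i> * of_real (snd q))))"
  proof (rule continuous_on_compose2[OF assms(1)])
    show "(\<lambda>q::(complex \<times> complex) \<times> real. (fst (fst q), snd (fst q) + of_real r * exp (2 * of_real pi * \<i> * of_real (snd q)))) `
        (A \<times> cbox 0 1) \<subseteq> S \<times> T"
    proof clarify
      fix e x :: complex and t :: real assume *: "(e, x) \<in> A"
      have "norm (exp (2 * of_real pi * \<i> * of_real t)) = 1"
        by (simp add: norm_exp_eq_Re)
      then have "dist x (x + of_real r * exp (2 * of_real pi * \<i> * of_real t)) \<le> r"
        using assms(4) by (simp add: dist_norm norm_mult)
      with * assms(2,3) show "fst (fst ((e, x), t)) \<in> S \<and>
          snd (fst ((e, x), t)) + of_real r * exp (2 * of_real pi * \<i> * of_real (snd ((e, x), t))) \<in> T"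
        by fastforce
    qed
  qed (auto intro!: continuous_intros)
  then show ?thesis
    using assms(4) by (auto simp: case_prod_unfold intro!: continuous_intros)
qed

lemma continuous_on_deriv_snd:
  assumes h: "sep_holomorphic h S T" and "open S" "open T"
  shows "continuous_on (S \<times> T) (\<lambda>(e, x). deriv (h e) x)"
proof -
  have "isCont (\<lambda>(e, x). deriv (h e) x) (e, a)" if ea: "e \<in> S" "a \<in> T" for e a
  proof -
    \<comment> \<open>Half the available radius, so that one circle radius \<open>r\<close> serves
      every centre in \<open>ball a r\<close>.\<close>
    obtain r where r: "r > 0" "cball a (2*r) \<subseteq> T"
    proof -
      obtain r where "r > 0" "cball a r \<subseteq> T"
        using \<open>open T\<close> ea open_contains_cball by blast
      then show thesis by (intro that[of "r/2"]) auto
    qed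
    have sub: "cball x r \<subseteq> T" if "x \<in> ball a r" for x
      using that r by (auto simp: subset_iff) (smt (verit) dist_triangle)
    define A where "A = S \<times> ball a r"
    have "continuous_on A (\<lambda>p. integral (cbox 0 1) (\<lambda>t::real. h (fst p)
        (snd p + of_real r * exp (2 * of_real pi * \<i> * of_real t)) * exp (- (2 * of_real pi * \<i> * of_real t)) / of_real r))"
    proof (rule integral_continuous_on_param, rule continuous_on_circle_integrand)
      show "continuous_on (S \<times> T) (\<lambda>(e, x). h e x)"
        by (rule sep_holomorphicD(1)[OF h])
    qed (use r sub in \<open>force simp: A_def\<close>)+
    then have "continuous_on A (\<lambda>(e, x). deriv (h e) x)"
    proof (rule continuous_on_eq)
      fix p assume "p \<in> A"
      then have "fst p \<in> S" "cball (snd p) r \<subseteq> T"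
        using sub[of "snd p"] by (auto simp only: A_def mem_Times_iff)
      from deriv_eq_circle_mean[OF sep_holomorphicD(3)[OF h this(1)] this(2) r(1)]
      show "integral (cbox 0 1) (\<lambda>t::real. h (fst p)
          (snd p + of_real r * exp (2 * of_real pi * \<i> * of_real t)) * exp (- (2 * of_real pi * \<i> * of_real t)) / of_real r)
          = (case p of (e, x) \<Rightarrow> deriv (h e) x)"
        by (simp add: case_prod_unfold)
    qed
    moreover have "open A" "(e, a) \<in> A"
      using \<open>open S\<close> ea r by (auto simp: A_def open_Times)
    ultimately show ?thesis
      using continuous_on_eq_continuous_at by blast
  qed
  then show ?thesis
    by (auto intro!: continuous_at_imp_continuous_on)
qed

lemma continuous_on_deriv_fst:
  assumes "sep_holomorphic h S T" "open S" "open T"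
  shows "continuous_on (S \<times> T) (\<lambda>(e, x). deriv (\<lambda>e. h e x) e)"
proof -
  have "continuous_on (S \<times> T) (\<lambda>q. (\<lambda>(x, e). deriv (\<lambda>e. h e x) e) (snd q, fst q))"
    by (rule continuous_on_compose2[OF continuous_on_deriv_snd[OF sep_holomorphic_swap[OF assms(1)] assms(3,2)]])
       (auto intro!: continuous_intros)
  then show ?thesis
    by (auto simp: case_prod_unfold)
qed

text \<open>The circle mean turns \<open>\<partial>\<^sub>x\<close> into an integral with a smooth kernel, so Leibniz' rule applies
  in the other variable; the formula also identifies the mixed derivative.\<close>

lemma has_field_derivative_deriv_snd:
  assumes h: "sep_holomorphic h S T" and S: "open S" "convex S" and T: "open T"
    and ex: "e \<in> S" "x \<in> T"
  obtains r where "0 < r" "cball x r \<subseteq> T"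
    "((\<lambda>e. deriv (h e) x) has_field_derivative integral (cbox 0 1)
    (\<lambda>t::real. deriv (\<lambda>e. h e (x + of_real r * exp (2 * of_real pi * \<i> * of_real t))) e *
        exp (- (2 * of_real pi * \<i> * of_real t)) / of_real r)) (at e)"
proof -
  obtain r where r: "r > 0" "cball x r \<subseteq> T"
    using T ex open_contains_cball by blast
  let ?p = "\<lambda>t::real. x + of_real r * exp (2 * of_real pi * \<i> * of_real t)"
  let ?w = "\<lambda>t::real. exp (- (2 * of_real pi * \<i> * of_real t)) / of_real r"
  have pT: "?p t \<in> T" for t
  proof -
    have "norm (exp (2 * of_real pi * \<i> * of_real t)) = 1"
      by (simp add: norm_exp_eq_Re)
    then have "dist x (?p t) \<le> r"
      using r by (simp add: dist_norm norm_mult)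
    then show ?thesis using r by auto
  qed
  have cont: "continuous_on (S \<times> cbox 0 1) (\<lambda>(e, t). g e (?p t) * ?w t)"
    if "continuous_on (S \<times> T) (\<lambda>(e, x). g e x)" for g :: "complex \<Rightarrow> complex \<Rightarrow> complex"
  proof -
    have "continuous_on (S \<times> cbox 0 1) (\<lambda>q. (\<lambda>(e, x). g e x) (fst q, ?p (snd q)))"
      by (rule continuous_on_compose2[OF that]) (auto intro!: continuous_intros pT)
    then show ?thesis
      using r by (auto simp: case_prod_unfold intro!: continuous_intros)
  qed
  have "((\<lambda>e. integral (cbox 0 1) (\<lambda>t. h e (?p t) * ?w t)) has_field_derivative
      integral (cbox 0 1) (\<lambda>t. deriv (\<lambda>e. h e (?p t)) e * ?w t)) (at e within S)"
  \<comment> \<open>This rule differentiates along a convex parameter set; hence the convexity of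
    \<open>S\<close>.\<close>
  proof (rule leibniz_rule_field_derivative)
    show "((\<lambda>e. h e (?p t) * ?w t) has_field_derivative deriv (\<lambda>e. h e (?p t)) e * ?w t) (at e within S)"
      if "e \<in> S" for e t
      by (rule DERIV_cmult_right, rule has_field_derivative_at_within,
          rule holomorphic_derivI[OF sep_holomorphicD(2)[OF h pT] S(1) that])
    show "(\<lambda>t. h e (?p t) * ?w t) integrable_on cbox 0 1" if "e \<in> S" for e
    proof (rule integrable_continuous)
      have "continuous_on (cbox 0 1) (\<lambda>t. (\<lambda>(e, t). h e (?p t) * ?w t) (e, t))"
        by (rule continuous_on_compose2[OF cont[OF sep_holomorphicD(1)[OF h]]])
           (use that in \<open>auto intro!: continuous_intros\<close>)
      then show "continuous_on (cbox 0 1) (\<lambda>t. h e (?p t) * ?w t)" by simp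
    qed
    show "continuous_on (S \<times> cbox 0 1) (\<lambda>(e, t). deriv (\<lambda>e. h e (?p t)) e * ?w t)"
      using cont[OF continuous_on_deriv_fst[OF h S(1) T]] .
  qed (use S ex in auto)
  then have "((\<lambda>e. integral (cbox 0 1) (\<lambda>t. h e (?p t) * ?w t)) has_field_derivative
      integral (cbox 0 1) (\<lambda>t. deriv (\<lambda>e. h e (?p t)) e * ?w t)) (at e)"
    by (simp only: at_within_open[OF ex(1) S(1)])
  then have "((\<lambda>e. deriv (h e) x) has_field_derivative
      integral (cbox 0 1) (\<lambda>t. deriv (\<lambda>e. h e (?p t)) e * ?w t)) (at e)"
    by (rule has_field_derivative_transform_within_open[OF _ S(1) ex(1)])
       (simp only: deriv_eq_circle_mean[OF sep_holomorphicD(3)[OF h] r(2,1)] times_divide_eq_right)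
  then show thesis using that[OF r] by (simp only: times_divide_eq_right)
qed

lemma sep_holomorphic_deriv_snd:
  assumes h: "sep_holomorphic h S T" and S: "open S" "convex S" and T: "open T"
  shows "sep_holomorphic (\<lambda>e x. deriv (h e) x) S T"
  unfolding sep_holomorphic_def
proof (intro conjI ballI)
  show "continuous_on (S \<times> T) (\<lambda>(e, x). deriv (h e) x)"
    by (rule continuous_on_deriv_snd[OF h S(1) T])
  show "(\<lambda>e. deriv (h e) x) holomorphic_on S" if "x \<in> T" for x
    unfolding holomorphic_on_open[OF S(1)]
    by (auto intro: has_field_derivative_deriv_snd[OF h S T _ that])
  show "(\<lambda>x. deriv (h e) x) holomorphic_on T" if "e \<in> S" for e
    by (rule holomorphic_deriv[OF sep_holomorphicD(3)[OF h that] T])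
qed

lemma sep_holomorphic_deriv_fst:
  assumes "sep_holomorphic h S T" "open S" "open T" "convex T"
  shows "sep_holomorphic (\<lambda>e x. deriv (\<lambda>e. h e x) e) S T"
  by (rule sep_holomorphic_swap[OF sep_holomorphic_deriv_snd[OF sep_holomorphic_swap]]) (rule assms)+

text \<open>Both mixed derivatives are the same circle mean: one by Leibniz' rule, the other by
  Cauchy's formula for the holomorphic function
  \<open>\<lambda>x. deriv (\<lambda>e. h e x) e\<close>.\<close>

lemma mixed_deriv_eq:
  assumes h: "sep_holomorphic h S T" and S: "open S" "convex S" and T: "open T" "convex T"
    and ex: "e \<in> S" "x \<in> T"
  shows "deriv (\<lambda>e. deriv (h e) x) e = deriv (\<lambda>x. deriv (\<lambda>e. h e x) e) x"
proof -
  obtain r where r: "0 < r" "cball x r \<subseteq> T"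
    "((\<lambda>e. deriv (h e) x) has_field_derivative integral (cbox 0 1)
    (\<lambda>t::real. deriv (\<lambda>e. h e (x + of_real r * exp (2 * of_real pi * \<i> * of_real t))) e *
        exp (- (2 * of_real pi * \<i> * of_real t)) / of_real r)) (at e)"
    by (rule has_field_derivative_deriv_snd[OF h S T(1) ex])
  have "(\<lambda>x. deriv (\<lambda>e. h e x) e) holomorphic_on T"
    using sep_holomorphicD(3)[OF sep_holomorphic_deriv_fst[OF h S(1) T] ex(1)] .
  from deriv_eq_circle_mean[OF this r(2,1)] r(3) show ?thesis
    by (simp add: DERIV_imp_deriv)
qed

section \<open>Iterated partial derivatives and real smoothness\<close>

definition D_fst :: "(complex \<Rightarrow> complex \<Rightarrow> complex) \<Rightarrow> complex \<Rightarrow> complex \<Rightarrow> complex" where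
  "D_fst h e x = deriv (\<lambda>e. h e x) e"

definition D_snd :: "(complex \<Rightarrow> complex \<Rightarrow> complex) \<Rightarrow> complex \<Rightarrow> complex \<Rightarrow> complex" where
  "D_snd h e x = deriv (h e) x"

lemma sep_holomorphic_iterated:
  assumes "sep_holomorphic h S T" "open S" "convex S" "open T" "convex T"
  shows "sep_holomorphic ((D_fst ^^ i) h) S T" "sep_holomorphic ((D_snd ^^ i) h) S T"
proof -
  show "sep_holomorphic ((D_fst ^^ i) h) S T"
    by (induction i) (use assms sep_holomorphic_deriv_fst in \<open>auto simp: D_fst_def[abs_def]\<close>)
  show "sep_holomorphic ((D_snd ^^ i) h) S T"
    by (induction i) (use assms sep_holomorphic_deriv_snd in \<open>auto simp: D_snd_def[abs_def]\<close>)
qed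

text \<open>In \<open>(D_fst ^^ i) ((D_snd ^^ j) h)\<close> a further \<open>e\<close>-derivative is
  added outside by definition, but an \<open>x\<close>-derivative has to pass the \<open>i\<close>
  operators \<open>D_fst\<close>. The induction keeps \<open>e\<close> arbitrary because
  \<open>deriv\<close> needs its hypothesis on a neighbourhood of \<open>e\<close>.\<close>

lemma D_snd_funpow_D_fst:
  assumes h: "sep_holomorphic h S T" and S: "open S" "convex S" and T: "open T" "convex T"
    and "e \<in> S" "x \<in> T"
  shows "D_snd ((D_fst ^^ i) h) e x = (D_fst ^^ i) (D_snd h) e x"
  using \<open>e \<in> S\<close>
proof (induction i arbitrary: e)
  case (Suc i)
  have "D_snd ((D_fst ^^ Suc i) h) e x = deriv (\<lambda>e. D_snd ((D_fst ^^ i) h) e x) e"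
    using mixed_deriv_eq[OF sep_holomorphic_iterated(1)[OF h S T] S T Suc.prems \<open>x \<in> T\<close>, of i]
    by (simp add: D_snd_def D_fst_def[abs_def])
  also have "\<dots> = deriv (\<lambda>e. (D_fst ^^ i) (D_snd h) e x) e"
    by (rule deriv_cong_ev) (use Suc S in \<open>auto intro!: eventually_nhds_in_open[THEN eventually_mono]\<close>)
  finally show ?case
    by (simp add: D_fst_def[of "(D_fst ^^ i) (D_snd h)"])
qed simp

lemma has_real_derivative_Re_of_real:
  assumes "(f has_field_derivative f') (at (of_real y))"
  shows "((\<lambda>y. Re (f (of_real y))) has_real_derivative Re f') (at y within A)"
  using has_vector_derivative_real_field[OF assms, THEN has_field_derivative_Re]
  by (rule has_field_derivative_at_within)

lemma smooth_family_on_Re: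
  assumes h: "sep_holomorphic h S T" and S: "open S" "convex S" and T: "open T" "convex T"
    and IJ: "of_real ` I \<subseteq> S" "of_real ` J \<subseteq> T"
  shows "smooth_family_on I J (\<lambda>e x. Re (h (of_real e) (of_real x)))"
proof -
  define g where "g i j = (D_fst ^^ i) ((D_snd ^^ j) h)" for i j
  have g: "sep_holomorphic (g i j) S T" for i j
    unfolding g_def by (intro sep_holomorphic_iterated h S T)
  show ?thesis
    unfolding smooth_family_on_def
  proof (intro exI[of _ "\<lambda>i j e x. Re (g i j (of_real e) (of_real x))"] conjI allI ballI)
    fix i j
    have "continuous_on (I \<times> J) (\<lambda>p. (\<lambda>(e, x). g i j e x) (of_real (fst p), of_real (snd p)))"
      by (rule continuous_on_compose2[OF sep_holomorphicD(1)[OF g]])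
         (use IJ in \<open>auto intro!: continuous_intros\<close>)
    then show "continuous_on (I \<times> J) (\<lambda>(e, x). Re (g i j (of_real e) (of_real x)))"
      by (auto simp: case_prod_unfold intro!: continuous_intros)
    fix e x assume ex: "e \<in> I" "x \<in> J"
    then have ex': "of_real e \<in> S" "of_real x \<in> T"
      using IJ by auto
    have "((\<lambda>e. g i j e (of_real x)) has_field_derivative g (Suc i) j (of_real e) (of_real x)) (at (of_real e))"
      using holomorphic_derivI[OF sep_holomorphicD(2)[OF g ex'(2)] S(1) ex'(1)]
      by (simp add: g_def D_fst_def)
    then show "((\<lambda>e'. Re (g i j (of_real e') (of_real x))) has_real_derivative
        Re (g (Suc i) j (of_real e) (of_real x))) (at e within I)"
      by (rule has_real_derivative_Re_of_real)
    have "(g i j (of_real e) has_field_derivative deriv (g i j (of_real e)) (of_real x)) (at (of_real x))"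
      using holomorphic_derivI[OF sep_holomorphicD(3)[OF g ex'(1)] T(1) ex'(2)] .
    moreover have "deriv (g i j (of_real e)) (of_real x) = g i (Suc j) (of_real e) (of_real x)"
      using D_snd_funpow_D_fst[OF sep_holomorphic_iterated(2)[OF h S T] S T ex', of i j]
      by (simp add: g_def D_snd_def)
    ultimately show "((\<lambda>x'. Re (g i j (of_real e) (of_real x'))) has_real_derivative
        Re (g i (Suc j) (of_real e) (of_real x))) (at x within J)"
      using has_real_derivative_Re_of_real by simp
  qed (simp add: g_def)
qed

lemma Cinf_on_smooth_family:
  assumes "smooth_family_on I J U" "e \<in> I"
  shows "Cinf_on J (U e)"
proof -
  obtain D where D: "D 0 0 = U"
    "\<And>i j e x. e \<in> I \<Longrightarrow> x \<in> J \<Longrightarrow> ((\<lambda>x'. D i j e x') has_real_derivative D i (Suc j) e x) (at x within J)"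
    using assms(1) unfolding smooth_family_on_def by (elim exE conjE) simp
  then show ?thesis
    unfolding Cinf_on_def using assms(2) by (intro exI[of _ "\<lambda>j. D 0 j e"]) auto
qed

section \<open>Closure properties of separate holomorphy\<close>

lemma sep_holomorphic_const_snd:
  assumes "f holomorphic_on S" shows "sep_holomorphic (\<lambda>e x. f e) S T"
  unfolding sep_holomorphic_def
  using assms holomorphic_on_imp_continuous_on[OF assms]
  by (auto simp: case_prod_unfold intro!: continuous_on_compose2[of S f _ fst] continuous_intros)

lemma sep_holomorphic_const_fst:
  assumes "f holomorphic_on T" shows "sep_holomorphic (\<lambda>e x. f x) S T"
  using sep_holomorphic_swap[OF sep_holomorphic_const_snd[OF assms]] by simp

lemma sep_holomorphic_add:
  assumes "sep_holomorphic f S T" "sep_holomorphic g S T"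
  shows "sep_holomorphic (\<lambda>e x. f e x + g e x) S T"
  using assms unfolding sep_holomorphic_def
  by (auto simp: case_prod_unfold intro!: continuous_intros holomorphic_intros)

lemma sep_holomorphic_diff:
  assumes "sep_holomorphic f S T" "sep_holomorphic g S T"
  shows "sep_holomorphic (\<lambda>e x. f e x - g e x) S T"
  using assms unfolding sep_holomorphic_def
  by (auto simp: case_prod_unfold intro!: continuous_intros holomorphic_intros)

lemma sep_holomorphic_mult:
  assumes "sep_holomorphic f S T" "sep_holomorphic g S T"
  shows "sep_holomorphic (\<lambda>e x. f e x * g e x) S T"
  using assms unfolding sep_holomorphic_def
  by (auto simp: case_prod_unfold intro!: continuous_intros holomorphic_intros)

lemma sep_holomorphic_divide:
  assumes "sep_holomorphic f S T" "sep_holomorphic g S T"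
    and "\<And>e x. e \<in> S \<Longrightarrow> x \<in> T \<Longrightarrow> g e x \<noteq> 0"
  shows "sep_holomorphic (\<lambda>e x. f e x / g e x) S T"
  using assms unfolding sep_holomorphic_def
  by (auto simp: case_prod_unfold intro!: continuous_intros holomorphic_intros)

lemma sep_holomorphic_power:
  assumes "sep_holomorphic f S T"
  shows "sep_holomorphic (\<lambda>e x. f e x ^ n) S T"
  using assms unfolding sep_holomorphic_def
  by (auto simp: case_prod_unfold intro!: continuous_intros holomorphic_intros)

lemma sep_holomorphic_const: "sep_holomorphic (\<lambda>e x. c) S T"
  by (intro sep_holomorphic_const_snd holomorphic_intros)

text \<open>Used with \<open>a = 1\<close> for the boundary values inside
  \<open>clamped\<close>.\<close>

lemma sep_holomorphic_eval_snd:
  assumes "sep_holomorphic f S T" "a \<in> T"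
  shows "sep_holomorphic (\<lambda>e x. f e a) S T"
  using assms by (intro sep_holomorphic_const_snd sep_holomorphicD(2))

lemmas sep_holomorphic_intros =
  sep_holomorphic_const sep_holomorphic_add sep_holomorphic_diff sep_holomorphic_mult
  sep_holomorphic_divide sep_holomorphic_power

text \<open>Weierstrass' convergence theorem in each variable separately; joint continuity passes to
  the limit by uniformity on the product.\<close>

lemma sep_holomorphic_uniform_limit:
  assumes f: "\<And>n. sep_holomorphic (\<lambda>e x. f n (e, x)) S T" and "open S" "open T"
    and lim: "uniform_limit (S \<times> T) f g sequentially"
  shows "sep_holomorphic (\<lambda>e x. g (e, x)) S T"
  unfolding sep_holomorphic_def
proof (intro conjI ballI)
  show "continuous_on (S \<times> T) (\<lambda>(e, x). g (e, x))"
    using uniform_limit_theorem[OF _ lim] sep_holomorphicD(1)[OF f] by simp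
  show "(\<lambda>e. g (e, x)) holomorphic_on S" if "x \<in> T" for x
  proof (rule holomorphic_uniform_sequence[OF \<open>open S\<close>, of "\<lambda>n e. f n (e, x)"])
    fix e assume "e \<in> S"
    then obtain d where d: "d > 0" "cball e d \<subseteq> S"
      using \<open>open S\<close> open_contains_cball by blast
    have "uniform_limit (cball e d) (\<lambda>n e. f n (e, x)) (\<lambda>e. g (e, x)) sequentially"
      using uniform_limit_compose'[OF lim, of "\<lambda>e. (e, x)" "cball e d"] d that by auto
    then show "\<exists>d>0. cball e d \<subseteq> S \<and> uniform_limit (cball e d) (\<lambda>n e. f n (e, x)) (\<lambda>e. g (e, x)) sequentially"
      using d by blast
  qed (use sep_holomorphicD(2)[OF f that] in auto)
  show "(\<lambda>x. g (e, x)) holomorphic_on T" if "e \<in> S" for e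
  proof (rule holomorphic_uniform_sequence[OF \<open>open T\<close>, of "\<lambda>n x. f n (e, x)"])
    fix x assume "x \<in> T"
    then obtain d where d: "d > 0" "cball x d \<subseteq> T"
      using \<open>open T\<close> open_contains_cball by blast
    have "uniform_limit (cball x d) (\<lambda>n x. f n (e, x)) (\<lambda>x. g (e, x)) sequentially"
      using uniform_limit_compose'[OF lim, of "\<lambda>x. (e, x)" "cball x d"] d that by auto
    then show "\<exists>d>0. cball x d \<subseteq> T \<and> uniform_limit (cball x d) (\<lambda>n x. f n (e, x)) (\<lambda>x. g (e, x)) sequentially"
      using d by blast
  qed (use sep_holomorphicD(3)[OF f that] in auto)
qed

section \<open>Primitives along rays from the origin\<close>

text \<open>The path integral of \<open>g\<close> along the segment from 0 to \<open>x\<close>,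
  taken over a fixed interval so that \<open>x\<close> is only a parameter.\<close>

definition prim :: "(complex \<Rightarrow> complex) \<Rightarrow> complex \<Rightarrow> complex" where
  "prim g x = x * integral (cbox 0 1) (\<lambda>t::real. g (of_real t * x))"

lemma scaled_in_ball: "t \<in> cbox 0 1 \<Longrightarrow> x \<in> ball 0 R \<Longrightarrow> complex_of_real t * x \<in> ball 0 R"
  by (auto simp: norm_mult intro!: le_less_trans[OF mult_left_le_one_le])

lemma prim_integrable:
  assumes "g holomorphic_on ball 0 R" "x \<in> ball 0 R"
  shows "(\<lambda>t::real. g (of_real t * x)) integrable_on cbox 0 1"
  by (intro integrable_continuous continuous_on_compose2[OF holomorphic_on_imp_continuous_on[OF assms(1)]]
        continuous_intros) (use scaled_in_ball[OF _ assms(2)] in auto)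

lemma prim_has_field_derivative:
  assumes g: "g holomorphic_on ball 0 R" and x: "x \<in> ball 0 R"
  shows "(prim g has_field_derivative g x) (at x)"
proof -
  obtain F where F: "\<And>x. x \<in> ball 0 R \<Longrightarrow> (F has_field_derivative g x) (at x within ball 0 R)"
    using holomorphic_convex_primitive'[OF convex_ball open_ball g] by blast
  \<comment> \<open>Any primitive on the convex disc will do: its increment from 0 is the path
    integral along the segment.\<close>
  have eq: "F y - F 0 = prim g y" if "y \<in> ball 0 R" for y
  proof -
    have "0 < R" using that by (auto intro: le_less_trans[OF norm_ge_zero])
    then have "path_image (linepath 0 y) \<subseteq> ball 0 R"
      using that closed_segment_subset[of 0 "ball 0 R" y] by (auto simp del: ball_eq_empty)
    then have "(g has_contour_integral (F y - F 0)) (linepath 0 y)"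
      using contour_integral_primitive[OF F, of "linepath 0 y"] by simp
    then have "((\<lambda>t. g (of_real t * y) * y) has_integral (F y - F 0)) (cbox 0 1)"
      unfolding has_contour_integral_linepath by (simp add: linepath_def scaleR_conv_of_real)
    then have "integral (cbox 0 1) (\<lambda>t. g (of_real t * y) * y) = F y - F 0"
      by (rule integral_unique)
    then show ?thesis
      by (simp add: prim_def mult.commute)
  qed
  have "((\<lambda>y. F y - F 0) has_field_derivative g x) (at x)"
    using DERIV_diff[OF F[OF x] DERIV_const] by (simp add: at_within_open[OF x open_ball])
  then show ?thesis
    by (rule has_field_derivative_transform_within_open[OF _ open_ball x]) (rule eq)
qed

lemma prim_bound:
  assumes "g holomorphic_on ball 0 R" "x \<in> ball 0 R" "\<And>y. y \<in> ball 0 R \<Longrightarrow> norm (g y) \<le> M"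
  shows "norm (prim g x) \<le> R * M"
proof -
  have M: "0 \<le> M"
    using assms(2,3) norm_ge_zero order_trans by blast
  have "norm (integral (cbox 0 1) (\<lambda>t::real. g (of_real t * x))) \<le> M * measure lborel (cbox 0 (1::real))"
    by (rule has_integral_bound[OF M integrable_integral[OF prim_integrable[OF assms(1,2)]]])
       (use assms(3) scaled_in_ball[OF _ assms(2)] in auto)
  then show ?thesis
    unfolding prim_def norm_mult using assms(2) M le_less_trans[OF norm_ge_zero, of x R]
    by (intro mult_mono) auto
qed

lemma prim_diff:
  assumes "g holomorphic_on ball 0 R" "h holomorphic_on ball 0 R" "x \<in> ball 0 R"
  shows "prim (\<lambda>y. g y - h y) x = prim g x - prim h x"
  using prim_integrable[OF assms(1,3)] prim_integrable[OF assms(2,3)]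
  by (simp add: prim_def integral_diff algebra_simps)

lemma prim_minus: "prim g (- x) = - prim (\<lambda>y. g (- y)) x"
  by (simp add: prim_def)

lemma prim_cnj: "cnj (prim g x) = prim (\<lambda>y. cnj (g (cnj y))) (cnj x)"
  by (simp add: prim_def integral_cnj)

lemma prim_cong:
  assumes "\<And>t. t \<in> {0..1} \<Longrightarrow> g (of_real t * x) = h (of_real t * x)"
  shows "prim g x = prim h x"
  unfolding prim_def using assms by (auto intro!: integral_cong)

lemma sep_holomorphic_prim:
  assumes f: "sep_holomorphic f S (ball 0 R)" and S: "open S" "convex S"
  shows "sep_holomorphic (\<lambda>e. prim (f e)) S (ball 0 R)"
  unfolding sep_holomorphic_def
proof (intro conjI ballI)
  have "continuous_on ((S \<times> ball 0 R) \<times> cbox 0 1)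
      (\<lambda>q::(complex \<times> complex) \<times> real. (\<lambda>(e, x). f e x) (fst (fst q), of_real (snd q) * snd (fst q)))"
    by (rule continuous_on_compose2[OF sep_holomorphicD(1)[OF f]])
       (use scaled_in_ball in \<open>force intro!: continuous_intros\<close>)+
  then have "continuous_on (S \<times> ball 0 R) (\<lambda>p. integral (cbox 0 1) (\<lambda>t::real. f (fst p) (of_real t * snd p)))"
    by (intro integral_continuous_on_param) (auto simp: case_prod_unfold)
  then show "continuous_on (S \<times> ball 0 R) (\<lambda>(e, x). prim (f e) x)"
    by (auto simp: prim_def case_prod_unfold intro!: continuous_intros)
  show "prim (f e) holomorphic_on ball 0 R" if "e \<in> S" for e
    unfolding holomorphic_on_open[OF open_ball]
    using prim_has_field_derivative[OF sep_holomorphicD(3)[OF f that]] by blast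
  show "(\<lambda>e. prim (f e) x) holomorphic_on S" if x: "x \<in> ball 0 R" for x
  proof -
    have "(\<lambda>e. integral (cbox 0 1) (\<lambda>t::real. f e (of_real t * x))) holomorphic_on S"
    proof (rule leibniz_rule_holomorphic)
      show "((\<lambda>e. f e (of_real t * x)) has_field_derivative deriv (\<lambda>e. f e (of_real t * x)) e) (at e within S)"
        if "e \<in> S" "t \<in> cbox 0 1" for e t
        using holomorphic_derivI[OF sep_holomorphicD(2)[OF f scaled_in_ball[OF that(2) x]] S(1) that(1)]
        by (rule has_field_derivative_at_within)
      show "(\<lambda>t. f e (of_real t * x)) integrable_on cbox 0 1" if "e \<in> S" for e
        by (rule prim_integrable[OF sep_holomorphicD(3)[OF f that] x])
      have "continuous_on (S \<times> cbox 0 1)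
          (\<lambda>q::complex \<times> real. (\<lambda>(e, x). deriv (\<lambda>e. f e x) e) (fst q, of_real (snd q) * x))"
        by (rule continuous_on_compose2[OF continuous_on_deriv_fst[OF f S(1) open_ball]])
           (use scaled_in_ball[OF _ x] in \<open>force intro!: continuous_intros\<close>)+
      then show "continuous_on (S \<times> cbox 0 1) (\<lambda>(e, t). deriv (\<lambda>e. f e (of_real t * x)) e)"
        by (simp add: case_prod_unfold)
    qed (rule S)
    then show ?thesis
      unfolding prim_def by (intro holomorphic_intros)
  qed
qed

section \<open>The clamped linear problem\<close>

text \<open>Sum over the four roots of \<open>l\<^sup>4 = - 4 k\<^sup>4\<close>.\<close>
definition root_sum :: "real \<Rightarrow> (complex \<Rightarrow> complex) \<Rightarrow> complex" where
  "root_sum k F = F (Complex k k) + F (Complex k (-k)) + F (Complex (-k) k) + F (Complex (-k) (-k))"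

lemma root_power4:
  "Complex k k ^ 4 = - of_real (4 * k^4)" "Complex k (-k) ^ 4 = - of_real (4 * k^4)"
  "Complex (-k) k ^ 4 = - of_real (4 * k^4)" "Complex (-k) (-k) ^ 4 = - of_real (4 * k^4)"
  by (simp_all add: power4_eq_xxxx complex_eq_iff algebra_simps)

lemma root_sum_uminus: "root_sum k (\<lambda>l. F (- l)) = root_sum k F"
proof -
  have "- Complex a b = Complex (-a) (-b)" for a b
    by (simp add: complex_eq_iff)
  then show ?thesis by (simp add: root_sum_def)
qed

lemma root_sum_cnj: "cnj (root_sum k F) = root_sum k (\<lambda>l. cnj (F (cnj l)))"
proof -
  have "cnj (Complex a b) = Complex a (-b)" for a b
    by (simp add: complex_eq_iff)
  then show ?thesis by (simp add: root_sum_def)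
qed

lemma root_sum_diff: "root_sum k (\<lambda>l. F l - G l) = root_sum k F - root_sum k G"
  by (simp add: root_sum_def)

lemma root_sum_mult_left: "root_sum k (\<lambda>l. c * F l) = c * root_sum k F"
  by (simp add: root_sum_def algebra_simps)

lemma root_sum_power_add4:
  "root_sum k (\<lambda>l. l ^ (m + 4) * F l) = - of_real (4 * k^4) * root_sum k (\<lambda>l. l ^ m * F l)"
  by (simp add: root_sum_def power_add root_power4 algebra_simps)

text \<open>The polynomial \<open>z^4 + 4 k^4\<close> has no middle terms, so its first three power
  sums vanish by Newton's identities. Hence \<open>g\<close> enters the derivatives of
  \<open>particular\<close> only at fourth order.\<close>

lemma root_sum_powers:
  "root_sum k (\<lambda>l. l ^ 1) = 0" "root_sum k (\<lambda>l. l ^ 2) = 0" "root_sum k (\<lambda>l. l ^ 3) = 0"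
  "root_sum k (\<lambda>l. l ^ 4) = - of_real (16 * k^4)"
  by (simp_all add: root_sum_def root_power4 power2_eq_square power3_eq_cube complex_eq_iff)

lemma has_field_derivative_root_sum:
  assumes "\<And>l. ((\<lambda>x. F l x) has_field_derivative F' l) (at x)"
  shows "((\<lambda>x. root_sum k (\<lambda>l. F l x)) has_field_derivative root_sum k F') (at x)"
  unfolding root_sum_def by (intro derivative_intros assms)

lemma norm_root_sum_le:
  assumes "\<And>l. norm (F l) \<le> B l * M"
  shows "norm (root_sum k F) \<le> (B (Complex k k) + B (Complex k (-k)) + B (Complex (-k) k) + B (Complex (-k) (-k))) * M"
  unfolding root_sum_def distrib_right by (intro norm_triangle_mono assms)

lemma sep_holomorphic_root_sum:
  assumes "\<And>l. sep_holomorphic (F l) S T"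
  shows "sep_holomorphic (\<lambda>e x. root_sum k (\<lambda>l. F l e x)) S T"
  unfolding root_sum_def by (intro sep_holomorphic_intros assms)

section \<open>Variation of constants\<close>

text \<open>The solution of \<open>y' = l y + g\<close> with \<open>y 0 = 0\<close>.\<close>

definition duhamel :: "complex \<Rightarrow> (complex \<Rightarrow> complex) \<Rightarrow> complex \<Rightarrow> complex" where
  "duhamel l g x = exp (l * x) * prim (\<lambda>t. exp (- (l * t)) * g t) x"

lemma duhamel_has_field_derivative:
  assumes "g holomorphic_on ball 0 R" "x \<in> ball 0 R"
  shows "(duhamel l g has_field_derivative l * duhamel l g x + g x) (at x)"
proof -
  have "(\<lambda>t. exp (- (l * t)) * g t) holomorphic_on ball 0 R"
    by (intro holomorphic_intros assms)
  note prim = prim_has_field_derivative[OF this assms(2)]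
  have "((\<lambda>x. exp (l * x)) has_field_derivative exp (l * x) * l) (at x)"
    by (auto intro!: derivative_eq_intros)
  from DERIV_mult[OF this prim] show ?thesis
    unfolding duhamel_def[abs_def]
    by (rule DERIV_cong) (simp add: exp_minus field_simps)
qed

lemma norm_exp_mult_le: "x \<in> ball 0 R \<Longrightarrow> norm (exp (l * x)) \<le> exp (norm l * R)" for l x :: complex
  by (rule order_trans[OF norm_exp]) (auto simp: norm_mult intro!: mult_left_mono)

lemma norm_duhamel_le:
  assumes "g holomorphic_on ball 0 R" "x \<in> ball 0 R" "\<And>y. y \<in> ball 0 R \<Longrightarrow> norm (g y) \<le> M"
  shows "norm (duhamel l g x) \<le> exp (norm l * R) * (R * exp (norm l * R)) * M"
proof -
  have "norm (prim (\<lambda>t. exp (- (l * t)) * g t) x) \<le> R * (exp (norm l * R) * M)"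
  proof (rule prim_bound)
    show "(\<lambda>t. exp (- (l * t)) * g t) holomorphic_on ball 0 R"
      by (intro holomorphic_intros assms)
    show "norm (exp (- (l * y)) * g y) \<le> exp (norm l * R) * M" if "y \<in> ball 0 R" for y
      unfolding norm_mult using norm_exp_mult_le[OF that, of "- l"] assms(3)[OF that]
      by (intro mult_mono) auto
  qed (rule assms)
  then have "norm (duhamel l g x) \<le> exp (norm l * R) * (R * (exp (norm l * R) * M))"
    unfolding duhamel_def norm_mult using norm_exp_mult_le[OF assms(2), of l] by (intro mult_mono) auto
  then show ?thesis by (simp add: mult.assoc)
qed

lemma duhamel_diff:
  assumes "g holomorphic_on ball 0 R" "h holomorphic_on ball 0 R" "x \<in> ball 0 R"
  shows "duhamel l (\<lambda>y. g y - h y) x = duhamel l g x - duhamel l h x"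
proof -
  have "prim (\<lambda>t. exp (- (l * t)) * g t - exp (- (l * t)) * h t) x =
      prim (\<lambda>t. exp (- (l * t)) * g t) x - prim (\<lambda>t. exp (- (l * t)) * h t) x"
    by (rule prim_diff[where R = R]) (intro holomorphic_intros assms)+
  then show ?thesis
    by (simp add: duhamel_def right_diff_distrib)
qed

text \<open>Reflecting \<open>x\<close> exchanges the roots \<open>l\<close> and \<open>- l\<close>,
  a permutation that leaves \<open>root_sum\<close> unchanged.\<close>

lemma duhamel_minus:
  assumes "\<And>y. y \<in> ball 0 R \<Longrightarrow> g (- y) = g y" "x \<in> ball 0 R"
  shows "duhamel l g (- x) = - duhamel (- l) g x"
proof -
  have "prim (\<lambda>t. exp (- (l * - t)) * g (- t)) x = prim (\<lambda>t. exp (- (- l * t)) * g t) x"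
    by (rule prim_cong) (use assms scaled_in_ball[OF _ assms(2)] in auto)
  then show ?thesis
    by (simp add: duhamel_def prim_minus)
qed

text \<open>On real arguments conjugation only moves \<open>l\<close> to \<open>cnj l\<close>, again
  a permutation of the roots.\<close>

lemma duhamel_cnj:
  assumes "\<And>y. y \<in> ball 0 R \<Longrightarrow> y \<in> \<real> \<Longrightarrow> g y \<in> \<real>" "x \<in> ball 0 R" "x \<in> \<real>"
  shows "cnj (duhamel l g x) = duhamel (cnj l) g x"
proof -
  have x: "cnj x = x" using assms(3) by (simp add: Reals_cnj_iff)
  have "prim (\<lambda>y. cnj (exp (- (l * cnj y)) * g (cnj y))) x = prim (\<lambda>t. exp (- (cnj l * t)) * g t) x"
  proof (rule prim_cong)
    fix t :: real assume "t \<in> {0..1}"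
    then have "of_real t * x \<in> ball 0 R" "of_real t * x \<in> \<real>"
      using scaled_in_ball[OF _ assms(2)] assms(3) by auto
    then have "cnj (g (of_real t * x)) = g (of_real t * x)"
      using assms(1) Reals_cnj_iff by blast
    then show "cnj (exp (- (l * cnj (of_real t * x))) * g (cnj (of_real t * x))) =
        exp (- (cnj l * (of_real t * x))) * g (of_real t * x)"
      by (simp add: x exp_cnj)
  qed
  then show ?thesis
    by (simp add: duhamel_def prim_cnj x exp_cnj)
qed

lemma sep_holomorphic_duhamel:
  assumes "sep_holomorphic f S (ball 0 R)" "open S" "convex S"
  shows "sep_holomorphic (\<lambda>e. duhamel l (f e)) S (ball 0 R)"
  unfolding duhamel_def[abs_def]
  by (intro sep_holomorphic_mult sep_holomorphic_prim assms)
     (rule sep_holomorphic_const_fst, intro holomorphic_intros)+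

text \<open>\<open>particular k m g\<close> is the \<open>m\<close>-th derivative of the solution of \<open>v'''' + 4 k\<^sup>4 v = g\<close>
  with vanishing Cauchy data at the origin.\<close>
definition particular :: "real \<Rightarrow> nat \<Rightarrow> (complex \<Rightarrow> complex) \<Rightarrow> complex \<Rightarrow> complex" where
  "particular k m g x = - of_real (1 / (16 * k^4)) * root_sum k (\<lambda>l. l ^ (m + 1) * duhamel l g x)"

text \<open>\<open>hom_sol k 0 x\<close> is \<open>4 cosh (k x) cos (k x)\<close>, and
  \<open>m\<close> counts derivatives. For \<open>k \<noteq> 0\<close> the even homogeneous
  solutions are spanned by \<open>hom_sol k 0\<close> and \<open>hom_sol k 2\<close>.\<close>

definition hom_sol :: "real \<Rightarrow> nat \<Rightarrow> complex \<Rightarrow> complex" where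
  "hom_sol k m x = root_sum k (\<lambda>l. l ^ m * exp (l * x))"

text \<open>The residue of \<open>1 / (z^4 + 4 k^4)\<close> at a root \<open>l\<close> is
  \<open>1 / (4 l^3) = - l / (16 k^4)\<close>, whence the factor and the exponent
  \<open>m + 1\<close>. Each \<open>duhamel\<close> term contributes a copy of \<open>g x\<close>;
  the last summand collects them.\<close>

lemma particular_has_field_derivative:
  assumes "g holomorphic_on ball 0 R" "x \<in> ball 0 R"
  shows "(particular k m g has_field_derivative
     particular k (m + 1) g x - of_real (1 / (16 * k^4)) * root_sum k (\<lambda>l. l ^ (m + 1)) * g x) (at x)"
proof -
  have "((\<lambda>x. - of_real (1 / (16 * k^4)) * root_sum k (\<lambda>l. l ^ (m + 1) * duhamel l g x)) has_field_derivative
      - of_real (1 / (16 * k^4)) * root_sum k (\<lambda>l. l ^ (m + 1) * (l * duhamel l g x + g x))) (at x)"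
    by (intro DERIV_cmult has_field_derivative_root_sum duhamel_has_field_derivative[OF assms])
  moreover have "root_sum k (\<lambda>l. l ^ (m + 1) * (l * duhamel l g x + g x)) =
      root_sum k (\<lambda>l. l ^ (m + 1 + 1) * duhamel l g x) + root_sum k (\<lambda>l. l ^ (m + 1)) * g x"
    unfolding root_sum_def by (simp add: algebra_simps)
  ultimately show ?thesis
    unfolding particular_def[abs_def] by (elim DERIV_cong) (simp only:, simp add: algebra_simps)
qed

lemma hom_sol_has_field_derivative: "(hom_sol k m has_field_derivative hom_sol k (m + 1) x) (at x)"
proof -
  have "((\<lambda>x. root_sum k (\<lambda>l. l ^ m * exp (l * x))) has_field_derivative
     root_sum k (\<lambda>l. l ^ (m + 1) * exp (l * x))) (at x)"
    by (rule has_field_derivative_root_sum) (auto intro!: derivative_eq_intros)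
  then show ?thesis by (simp add: hom_sol_def[abs_def])
qed

lemma particular_add4: "particular k (m + 4) g x = - of_real (4 * k^4) * particular k m g x"
  using root_sum_power_add4[of k "m + 1" "\<lambda>l. duhamel l g x"]
  by (simp add: particular_def add.commute add.left_commute)

lemma hom_sol_add4: "hom_sol k (m + 4) x = - of_real (4 * k^4) * hom_sol k m x"
  unfolding hom_sol_def by (rule root_sum_power_add4)

section \<open>The clamped boundary conditions\<close>

text \<open>The determinant of the conditions \<open>v 1 = v' 1 = 0\<close> on the span of
  \<open>hom_sol k 0\<close> and \<open>hom_sol k 2\<close>.\<close>

definition clamp_det :: "real \<Rightarrow> complex" where
  "clamp_det k = hom_sol k 0 1 * hom_sol k 3 1 - hom_sol k 1 1 * hom_sol k 2 1"

text \<open>\<open>clamped k m g\<close> is the \<open>m\<close>-th derivative of the solution of \<open>v'''' + 4 k\<^sup>4 v = g\<close>, \<open>v 1 = v' 1 = 0\<close>,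
  with even homogeneous part; the two coefficients come from Cramer's rule.\<close>
definition clamped :: "real \<Rightarrow> nat \<Rightarrow> (complex \<Rightarrow> complex) \<Rightarrow> complex \<Rightarrow> complex" where
  "clamped k m g x = particular k m g x
     - (particular k 0 g 1 * hom_sol k 3 1 - particular k 1 g 1 * hom_sol k 2 1) / clamp_det k * hom_sol k m x
     - (particular k 1 g 1 * hom_sol k 0 1 - particular k 0 g 1 * hom_sol k 1 1) / clamp_det k * hom_sol k (m + 2) x"

lemma exp_Complex_real: "exp (Complex a b) = Complex (exp a * cos b) (exp a * sin b)"
  by (simp add: complex_eq_iff Re_exp Im_exp)

lemma clamp_det_eq: "clamp_det k = - of_real (32 * k^3 * (cos k * sin k + cosh k * sinh k))"
proof -
  define p q c s where "p = exp k" and "q = exp (- k)" and "c = cos k" and "s = sin k"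
  \<comment> \<open>With exponentials, sine and cosine replaced by letters, these two relations
    reduce the determinant to polynomial algebra.\<close>
  have rel: "p * q = 1" "c * c = 1 - s * s"
    using sin_cos_squared_add[of k] by (simp_all add: p_def q_def c_def s_def exp_minus power2_eq_square)
  have e: "exp (Complex k k) = Complex (p * c) (p * s)" "exp (Complex k (-k)) = Complex (p * c) (- p * s)"
     "exp (Complex (-k) k) = Complex (q * c) (q * s)" "exp (Complex (-k) (-k)) = Complex (q * c) (- q * s)"
    by (simp_all add: exp_Complex_real p_def q_def c_def s_def)
  have h0: "hom_sol k 0 1 = of_real (2 * (p + q) * c)"
    and h1: "hom_sol k 1 1 = of_real (2 * k * ((p - q) * c - (p + q) * s))"
    and h2: "hom_sol k 2 1 = of_real (- 4 * k^2 * (p - q) * s)"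
    and h3: "hom_sol k 3 1 = of_real (- 4 * k^3 * ((p + q) * s + (p - q) * c))"
    by (simp_all add: hom_sol_def root_sum_def e complex_eq_iff power2_eq_square power3_eq_cube algebra_simps)
  have "(2 * (p + q) * c) * (- 4 * k^3 * ((p + q) * s + (p - q) * c)) -
      (2 * k * ((p - q) * c - (p + q) * s)) * (- 4 * k^2 * (p - q) * s)
      = - (32 * k^3 * (c * s + ((p + q) / 2) * ((p - q) / 2)))"
    using rel by (simp add: field_simps power2_eq_square power3_eq_cube) algebra
  then have "clamp_det k = of_real (- (32 * k^3 * (c * s + ((p + q) / 2) * ((p - q) / 2))))"
    unfolding clamp_det_def h0 h1 h2 h3 by (simp only: of_real_mult[symmetric] of_real_diff[symmetric])
  then show ?thesis
    by (simp add: p_def q_def c_def s_def cosh_field_def sinh_field_def)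
qed

text \<open>The chain \<open>\<bar>sin k * cos k\<bar> \<le> k \<le> sinh k < sinh k * cosh
  k\<close> excludes a zero, so no nonzero even homogeneous solution is clamped.\<close>

lemma clamp_det_nonzero:
  assumes "k > 0"
  shows "clamp_det k \<noteq> 0"
proof -
  have "k \<le> sinh k"
    using real_le_x_sinh[of k] assms by (simp add: sinh_field_def exp_minus)
  moreover have "\<bar>sin k * cos k\<bar> \<le> k * 1"
    unfolding abs_mult using abs_sin_x_le_abs_x[of k] assms by (intro mult_mono) auto
  moreover have "cosh k > 1"
  proof (rule ccontr)
    assume "\<not> cosh k > 1"
    then have "cosh k = 1" using cosh_real_ge_1[of k] by simp
    then have "sinh k = 0" using sinh_square_eq[of k] by simp
    then show False using assms by simp
  qed
  then have "sinh k * 1 < sinh k * cosh k"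
    using assms by (intro mult_strict_left_mono) auto
  ultimately have "cos k * sin k + cosh k * sinh k > 0"
    by (simp add: mult.commute)
  then have "32 * k^3 * (cos k * sin k + cosh k * sinh k) \<noteq> 0"
    using assms by simp
  then show ?thesis
    unfolding clamp_det_eq neg_equal_0_iff_equal of_real_eq_0_iff .
qed

lemma clamped_has_field_derivative_aux:
  assumes "g holomorphic_on ball 0 R" "x \<in> ball 0 R"
  shows "(clamped k m g has_field_derivative
     clamped k (m + 1) g x - of_real (1 / (16 * k^4)) * root_sum k (\<lambda>l. l ^ (m + 1)) * g x) (at x)"
proof -
  note [derivative_intros] = particular_has_field_derivative[OF assms] hom_sol_has_field_derivative
  show ?thesis
    unfolding clamped_def[abs_def]
    by (rule derivative_eq_intros refl)+ (simp add: algebra_simps)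
qed

text \<open>The extra multiple of \<open>g\<close> is a power sum of the roots: it is zero in the
  first three derivatives and has coefficient 1 in the fourth, where \<open>clamped k 4\<close>
  folds back to \<open>- 4 k^4\<close> times \<open>clamped k 0\<close>.\<close>

lemma clamped_has_field_derivative:
  assumes "g holomorphic_on ball 0 R" "x \<in> ball 0 R"
  shows "m < 3 \<Longrightarrow> (clamped k m g has_field_derivative clamped k (m + 1) g x) (at x)"
    and "k \<noteq> 0 \<Longrightarrow> (clamped k 3 g has_field_derivative g x - of_real (4 * k^4) * clamped k 0 g x) (at x)"
proof -
  assume "m < 3"
  then have "m + 1 = 1 \<or> m + 1 = 2 \<or> m + 1 = 3" by auto
  then have "root_sum k (\<lambda>l. l ^ (m + 1)) = 0"
    using root_sum_powers(1-3)[of k] by metis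
  with clamped_has_field_derivative_aux[OF assms, of k m]
  show "(clamped k m g has_field_derivative clamped k (m + 1) g x) (at x)" by simp
next
  assume "k \<noteq> 0"
  have "clamped k 4 g x = - of_real (4 * k^4) * clamped k 0 g x"
    using particular_add4[of k 0 g x] hom_sol_add4[of k 0 x] hom_sol_add4[of k 2 x]
    by (simp add: clamped_def algebra_simps del: One_nat_def add_2_eq_Suc')
  moreover have "of_real (1 / (16 * k^4)) * root_sum k (\<lambda>l. l ^ (3 + 1)) = (-1 :: complex)"
    using \<open>k \<noteq> 0\<close> by (simp add: root_sum_powers)
  ultimately show "(clamped k 3 g has_field_derivative g x - of_real (4 * k^4) * clamped k 0 g x) (at x)"
    using clamped_has_field_derivative_aux[OF assms, of k 3] by (elim DERIV_cong) (simp only:, simp)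
qed

text \<open>Cramer's rule: once multiplied by the determinant, both conditions are polynomial
  identities in the values at 1.\<close>

lemma clamped_boundary:
  assumes "k > 0"
  shows "clamped k 0 g 1 = 0" "clamped k 1 g 1 = 0"
proof -
  have [simp]: "clamp_det k \<noteq> 0"
    using assms by (rule clamp_det_nonzero)
  have "clamp_det k * clamped k 0 g 1 = 0" "clamp_det k * clamped k 1 g 1 = 0"
    by (simp_all add: clamped_def right_diff_distrib)
       (simp_all add: clamp_det_def algebra_simps eval_nat_numeral)
  then show "clamped k 0 g 1 = 0" "clamped k 1 g 1 = 0" by auto
qed

text \<open>Negating \<open>x\<close> permutes the roots, and every root factor contributes a sign.
  The shift by 2 in the second homogeneous term leaves the sign unchanged.\<close>

lemma clamped_minus:
  assumes "\<And>y. y \<in> ball 0 R \<Longrightarrow> g (- y) = g y" "x \<in> ball 0 R"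
  shows "clamped k m g (- x) = (-1) ^ m * clamped k m g x"
proof -
  have sgn: "(-1) ^ n * ((- l) ^ n * z) = l ^ n * z" for l z :: complex and n
    by (simp add: mult.assoc[symmetric] power_mult_distrib[symmetric])
  have h: "hom_sol k n (- x) = (-1) ^ n * hom_sol k n x" for n
  proof -
    have "hom_sol k n (- x) = root_sum k (\<lambda>l. (-1) ^ n * ((- l) ^ n * exp ((- l) * x)))"
      unfolding hom_sol_def by (simp add: sgn)
    then show ?thesis
      using root_sum_uminus[of k "\<lambda>l. l ^ n * exp (l * x)"] by (simp only: root_sum_mult_left hom_sol_def)
  qed
  have d: "duhamel l g (- x) = - duhamel (- l) g x" for l
    by (rule duhamel_minus[of R]) (use assms in auto)
  \<comment> \<open>The sign from \<open>duhamel\<close> compensates the extra root factor in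
    \<open>l ^ (m + 1)\<close>.\<close>
  have "(-1) ^ m * ((- l) ^ (m + 1) * z) = l ^ (m + 1) * - z" for l z :: complex
    using sgn[of m l "- l * z"] by (simp add: mult_ac)
  then have "particular k m g (- x) = - of_real (1 / (16 * k^4)) *
      root_sum k (\<lambda>l. (-1) ^ m * ((- l) ^ (m + 1) * duhamel (- l) g x))"
    unfolding particular_def d by (simp only:)
  also have "\<dots> = (-1) ^ m * particular k m g x"
    using root_sum_uminus[of k "\<lambda>l. l ^ (m + 1) * duhamel l g x"]
    by (simp only: root_sum_mult_left particular_def mult_ac)
  finally show ?thesis
    unfolding clamped_def h by (simp add: algebra_simps)
qed

lemma clamped_real:
  assumes g: "\<And>y. y \<in> ball 0 R \<Longrightarrow> y \<in> \<real> \<Longrightarrow> g y \<in> \<real>" and x: "x \<in> ball 0 R" "x \<in> \<real>" and "1 < R"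
  shows "clamped k m g x \<in> \<real>"
proof -
  have h: "hom_sol k n y \<in> \<real>" if "y \<in> \<real>" for n y
    using that unfolding hom_sol_def Reals_cnj_iff root_sum_cnj by (simp add: exp_cnj)
  have p: "particular k n g y \<in> \<real>" if "y \<in> ball 0 R" "y \<in> \<real>" for n y
    using duhamel_cnj[OF g that] unfolding particular_def Reals_cnj_iff complex_cnj_mult root_sum_cnj by simp
  have "(1::complex) \<in> ball 0 R" using \<open>1 < R\<close> by simp
  with x show ?thesis
    unfolding clamped_def clamp_det_def by (intro Reals_diff Reals_mult Reals_divide h p) auto
qed

lemma clamped_diff:
  assumes "g holomorphic_on ball 0 R" "h holomorphic_on ball 0 R" "x \<in> ball 0 R" "1 < R"
  shows "clamped k m (\<lambda>y. g y - h y) x = clamped k m g x - clamped k m h x"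
proof -
  have p: "particular k n (\<lambda>y. g y - h y) y = particular k n g y - particular k n h y" if "y \<in> ball 0 R" for n y
    unfolding particular_def duhamel_diff[OF assms(1,2) that] right_diff_distrib root_sum_diff by simp
  have "(1::complex) \<in> ball 0 R" using \<open>1 < R\<close> by simp
  then show ?thesis
    unfolding clamped_def p[OF assms(3)]
    by (simp only: p) (simp add: diff_divide_distrib add_divide_distrib algebra_simps)
qed

section \<open>Sup-norm bounds\<close>

text \<open>Phrased with an explicit bound \<open>M\<close> because a holomorphic function on the
  open disc need not have a finite supremum.\<close>

definition sup_bounded :: "real \<Rightarrow> ((complex \<Rightarrow> complex) \<Rightarrow> complex \<Rightarrow> complex) \<Rightarrow> real \<Rightarrow> bool" where
  "sup_bounded R T C \<longleftrightarrow> C \<ge> 0 \<and> (\<forall>g M x. g holomorphic_on ball 0 R \<longrightarrow>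
     (\<forall>y\<in>ball 0 R. norm (g y) \<le> M) \<longrightarrow> x \<in> ball 0 R \<longrightarrow> norm (T g x) \<le> C * M)"

lemma sup_boundedD:
  assumes "sup_bounded R T C" "g holomorphic_on ball 0 R" "\<And>y. y \<in> ball 0 R \<Longrightarrow> norm (g y) \<le> M" "x \<in> ball 0 R"
  shows "norm (T g x) \<le> C * M"
  using assms unfolding sup_bounded_def by blast

lemma sup_bounded_nonneg: "sup_bounded R T C \<Longrightarrow> C \<ge> 0"
  by (simp add: sup_bounded_def)

lemma particular_bounded: "\<exists>C. sup_bounded R (particular k m) C"
proof -
  \<comment> \<open>\<open>\<bar>R\<bar>\<close> keeps the constant nonnegative even when the disc
    is empty.\<close>
  define B where "B l = norm l ^ (m + 1) * (exp (norm l * R) * (\<bar>R\<bar> * exp (norm l * R)))" for l :: complex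
  define C where "C = 1 / (16 * k^4) * (B (Complex k k) + B (Complex k (-k)) + B (Complex (-k) k) + B (Complex (-k) (-k)))"
  have B0: "B l \<ge> 0" for l by (simp add: B_def)
  have "norm (particular k m g x) \<le> C * M"
    if g: "g holomorphic_on ball 0 R" and M: "\<forall>y\<in>ball 0 R. norm (g y) \<le> M" and x: "x \<in> ball 0 R" for g M x
  proof -
    have "R > 0" using x by (auto intro: le_less_trans[OF norm_ge_zero])
    have "norm (l ^ (m + 1) * duhamel l g x) \<le> B l * M" for l
      unfolding norm_mult norm_power B_def mult.assoc[of "norm l ^ (m + 1)"]
      using norm_duhamel_le[OF g x, of M l] M \<open>R > 0\<close> by (intro mult_left_mono) auto
    from norm_root_sum_le[OF this, of k] show ?thesis
      unfolding particular_def norm_mult C_def mult.assoc[of "1 / (16 * k^4)"]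
      by (intro mult_mono) (auto simp: norm_mult norm_divide norm_power)
  qed
  moreover have "C \<ge> 0" unfolding C_def by (intro mult_nonneg_nonneg add_nonneg_nonneg B0) auto
  ultimately show ?thesis unfolding sup_bounded_def by blast
qed

lemma hom_sol_bounded: "\<exists>C\<ge>0. \<forall>x\<in>ball 0 R. norm (hom_sol k m x) \<le> C"
proof -
  define B where "B l = norm l ^ m * exp (norm l * R)" for l :: complex
  have "norm (hom_sol k m x) \<le> (B (Complex k k) + B (Complex k (-k)) + B (Complex (-k) k) + B (Complex (-k) (-k))) * 1"
    if "x \<in> ball 0 R" for x
    unfolding hom_sol_def using norm_exp_mult_le[OF that]
    by (intro norm_root_sum_le) (auto simp: B_def norm_mult norm_power intro!: mult_left_mono)
  moreover have "0 \<le> (B (Complex k k) + B (Complex k (-k)) + B (Complex (-k) k) + B (Complex (-k) (-k))) * 1"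
    by (simp add: B_def)
  ultimately show ?thesis by blast
qed

lemma clamped_bounded:
  assumes "1 < R"
  shows "\<exists>C. sup_bounded R (clamped k m) C"
proof -
  obtain Cm C0 C1 where bd: "sup_bounded R (particular k m) Cm" "sup_bounded R (particular k 0) C0"
      "sup_bounded R (particular k 1) C1"
    using particular_bounded[of R k m] particular_bounded[of R k 0] particular_bounded[of R k 1] by (elim exE)
  obtain Hm H2 where H: "Hm \<ge> 0" "\<forall>x\<in>ball 0 R. norm (hom_sol k m x) \<le> Hm"
      "H2 \<ge> 0" "\<forall>x\<in>ball 0 R. norm (hom_sol k (m + 2) x) \<le> H2"
    using hom_sol_bounded[of R k m] hom_sol_bounded[of R k "m + 2"] by (elim exE conjE)
  define a where "a n = norm (hom_sol k n 1)" for n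
  define d where "d = norm (clamp_det k)"
  define C where "C = Cm + (C0 * a 3 + C1 * a 2) / d * Hm + (C1 * a 0 + C0 * a 1) / d * H2"
  have "norm (clamped k m g x) \<le> C * M"
    if g: "g holomorphic_on ball 0 R" and M: "\<forall>y\<in>ball 0 R. norm (g y) \<le> M" and x: "x \<in> ball 0 R" for g M x
  proof -
    have one: "(1::complex) \<in> ball 0 R" using assms by simp
    have p0: "norm (particular k 0 g 1) \<le> C0 * M" and p1: "norm (particular k 1 g 1) \<le> C1 * M"
      and pm: "norm (particular k m g x) \<le> Cm * M"
      using sup_boundedD[OF bd(2) g _ one] sup_boundedD[OF bd(3) g _ one] sup_boundedD[OF bd(1) g _ x] M by auto
    have e: "norm (u * hom_sol k i 1 - w * hom_sol k j 1) \<le> U * a i + W * a j"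
      if "norm u \<le> U" "norm w \<le> W" for u w U W i j
      by (rule order_trans[OF norm_triangle_ineq4]) (simp add: a_def norm_mult add_mono mult_right_mono that)
    have t: "norm (u / clamp_det k * w) \<le> U / d * W" if "norm u \<le> U" "norm w \<le> W" for u w U W
      unfolding norm_mult norm_divide d_def using that order_trans[OF norm_ge_zero that(1)]
      by (intro mult_mono divide_right_mono divide_nonneg_nonneg norm_ge_zero)
    have "norm (hom_sol k m x) \<le> Hm" "norm (hom_sol k (m + 2) x) \<le> H2"
      using H x by auto
    note t1 = t[OF e[OF p0 p1, of 3 2] this(1)] and t2 = t[OF e[OF p1 p0, of 0 1] this(2)]
    have "norm (clamped k m g x) \<le> Cm * M + ((C0 * M) * a 3 + (C1 * M) * a 2) / d * Hm + ((C1 * M) * a 0 + (C0 * M) * a 1) / d * H2"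
      unfolding clamped_def
      by (rule order_trans[OF norm_triangle_ineq4 add_mono[OF order_trans[OF norm_triangle_ineq4 add_mono[OF pm t1]] t2]])
    also have "\<dots> = C * M" by (simp add: C_def algebra_simps add_divide_distrib)
    finally show ?thesis .
  qed
  moreover have "C \<ge> 0" using bd[THEN sup_bounded_nonneg] H by (simp add: C_def a_def d_def)
  ultimately show ?thesis unfolding sup_bounded_def by blast
qed

lemma sep_holomorphic_clamped:
  assumes f: "sep_holomorphic f S (ball 0 R)" and S: "open S" "convex S" and "1 < R"
  shows "sep_holomorphic (\<lambda>e. clamped k m (f e)) S (ball 0 R)"
proof -
  have p: "sep_holomorphic (\<lambda>e. particular k n (f e)) S (ball 0 R)" for n
    unfolding particular_def[abs_def]
    by (intro sep_holomorphic_mult sep_holomorphic_const sep_holomorphic_root_sum sep_holomorphic_duhamel f S)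
  have "(1::complex) \<in> ball 0 R" using \<open>1 < R\<close> by simp
  note p1 = sep_holomorphic_eval_snd[OF p this]
  have h: "sep_holomorphic (\<lambda>e x. hom_sol k n x) S (ball 0 R)" for n
    unfolding hom_sol_def root_sum_def by (intro sep_holomorphic_const_fst holomorphic_intros)
  show ?thesis
    \<comment> \<open>\<open>divide_inverse\<close> turns the determinant into a constant factor,
      which avoids the division rule and its nonvanishing condition.\<close>
    unfolding clamped_def[abs_def] divide_inverse
    by (intro sep_holomorphic_diff sep_holomorphic_mult sep_holomorphic_const p p1 h)
qed

section \<open>Strict differentiability of the nonlinearity\<close>

text \<open>Both points approach \<open>a\<close> independently: ordinary differentiability at
  \<open>a\<close> would not bound \<open>f x - f y - L (x - y)\<close> by a small multiple of the
  distance from \<open>x\<close> to \<open>y\<close>. The filter is \<open>nhds\<close>, since the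
  remainder vanishes on the diagonal.\<close>

definition strict_diff :: "('a::real_normed_vector \<Rightarrow> complex) \<Rightarrow> ('a \<Rightarrow> complex) \<Rightarrow> 'a \<Rightarrow> bool" where
  "strict_diff f L a \<longleftrightarrow> bounded_linear L \<and> isCont f a \<and>
     (\<lambda>z. f (fst z) - f (snd z) - L (fst z - snd z)) \<in> o[nhds (a, a)](\<lambda>z. of_real (norm (fst z - snd z)))"

lemma bounded_linear_bigo:
  fixes L :: "'a::real_normed_vector \<Rightarrow> complex"
  assumes "bounded_linear L"
  shows "(\<lambda>z. L (fst z - snd z)) \<in> O[F](\<lambda>z. of_real (norm (fst z - snd z)))"
proof -
  obtain K where "\<And>x. norm (L x) \<le> norm x * K"
    using bounded_linear.bounded[OF assms] by auto
  then show ?thesis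
    by (intro bigoI[where c = K]) (auto simp: mult.commute)
qed

lemma isCont_fst_snd_smallo:
  fixes f :: "'a::real_normed_vector \<Rightarrow> complex"
  assumes "isCont f a"
  shows "(\<lambda>z. f (fst z) - f a) \<in> o[nhds (a, a)](\<lambda>_. 1)" "(\<lambda>z. f (snd z) - f a) \<in> o[nhds (a, a)](\<lambda>_. 1)"
    "(\<lambda>z. f (fst z)) \<in> O[nhds (a, a)](\<lambda>_. 1)" "(\<lambda>z. f (snd z)) \<in> O[nhds (a, a)](\<lambda>_. 1)"
proof -
  have f: "(f \<longlongrightarrow> f a) (nhds a)"
    using assms by (simp add: continuous_at tendsto_at_iff_tendsto_nhds)
  have "((\<lambda>z. f (fst z)) \<longlongrightarrow> f a) (nhds (a, a))" "((\<lambda>z. f (snd z)) \<longlongrightarrow> f a) (nhds (a, a))"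
    using filterlim_compose[OF f, of fst "nhds (a, a)"] filterlim_compose[OF f, of snd "nhds (a, a)"]
      tendsto_fst[OF filterlim_ident, of "(a, a)"] tendsto_snd[OF filterlim_ident, of "(a, a)"]
    by simp_all
  note lim = this
  from lim show "(\<lambda>z. f (fst z)) \<in> O[nhds (a, a)](\<lambda>_. 1)" "(\<lambda>z. f (snd z)) \<in> O[nhds (a, a)](\<lambda>_. 1)"
    by (auto intro!: bigoI_tendsto[where c = "f a"])
  from lim show "(\<lambda>z. f (fst z) - f a) \<in> o[nhds (a, a)](\<lambda>_. 1)" "(\<lambda>z. f (snd z) - f a) \<in> o[nhds (a, a)](\<lambda>_. 1)"
    by (auto intro!: smalloI_tendsto simp: LIM_zero_iff)
qed

section \<open>Calculus of strict derivatives\<close>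

lemma strict_diff_linear:
  assumes "bounded_linear L"
  shows "strict_diff L L a"
  using assms by (simp add: strict_diff_def linear_continuous_at linear_diff[OF bounded_linear.linear[OF assms]])

lemma strict_diff_const: "strict_diff (\<lambda>_. c) (\<lambda>_. 0) a"
  by (simp add: strict_diff_def)

lemma strict_diff_add:
  assumes "strict_diff f L a" "strict_diff g M a"
  shows "strict_diff (\<lambda>x. f x + g x) (\<lambda>d. L d + M d) a"
proof -
  have "(\<lambda>z. (f (fst z) - f (snd z) - L (fst z - snd z)) + (g (fst z) - g (snd z) - M (fst z - snd z)))
      \<in> o[nhds (a, a)](\<lambda>z. of_real (norm (fst z - snd z)))"
    by (rule sum_in_smallo(1)) (use assms in \<open>simp_all add: strict_diff_def\<close>)
  then show ?thesis
    using assms by (auto simp: strict_diff_def algebra_simps intro!: bounded_linear_add)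
qed

text \<open>The remainder splits into four products: twice a bounded value times the remainder of
  the other factor, and twice a vanishing increment times a linear term.\<close>

lemma strict_diff_mult:
  assumes f: "strict_diff f L a" and g: "strict_diff g M a"
  shows "strict_diff (\<lambda>x. f x * g x) (\<lambda>d. f a * M d + L d * g a) a"
proof -
  let ?N = "\<lambda>z. of_real (norm (fst z - snd z)) :: complex"
  have bl: "bounded_linear L" "bounded_linear M" and c: "isCont f a" "isCont g a"
    and o: "(\<lambda>z. f (fst z) - f (snd z) - L (fst z - snd z)) \<in> o[nhds (a, a)](?N)"
      "(\<lambda>z. g (fst z) - g (snd z) - M (fst z - snd z)) \<in> o[nhds (a, a)](?N)"
    using f g by (auto simp: strict_diff_def)
  have "(\<lambda>z. f (fst z) * (g (fst z) - g (snd z) - M (fst z - snd z))) \<in> o[nhds (a, a)](\<lambda>z. 1 * ?N z)"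
    by (rule landau_o.big_small_mult[OF isCont_fst_snd_smallo(3)[OF c(1)] o(2)])
  moreover have "(\<lambda>z. (f (fst z) - f a) * M (fst z - snd z)) \<in> o[nhds (a, a)](\<lambda>z. 1 * ?N z)"
    by (rule landau_o.small_big_mult[OF isCont_fst_snd_smallo(1)[OF c(1)] bounded_linear_bigo[OF bl(2)]])
  moreover have "(\<lambda>z. g (snd z) * (f (fst z) - f (snd z) - L (fst z - snd z))) \<in> o[nhds (a, a)](\<lambda>z. 1 * ?N z)"
    by (rule landau_o.big_small_mult[OF isCont_fst_snd_smallo(4)[OF c(2)] o(1)])
  moreover have "(\<lambda>z. (g (snd z) - g a) * L (fst z - snd z)) \<in> o[nhds (a, a)](\<lambda>z. 1 * ?N z)"
    by (rule landau_o.small_big_mult[OF isCont_fst_snd_smallo(2)[OF c(2)] bounded_linear_bigo[OF bl(1)]])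
  ultimately have "(\<lambda>z. (f (fst z) * (g (fst z) - g (snd z) - M (fst z - snd z)) + (f (fst z) - f a) * M (fst z - snd z)) +
      (g (snd z) * (f (fst z) - f (snd z) - L (fst z - snd z)) + (g (snd z) - g a) * L (fst z - snd z)))
      \<in> o[nhds (a, a)](\<lambda>z. 1 * ?N z)"
    by (intro sum_in_smallo)
  also have "(\<lambda>z. (f (fst z) * (g (fst z) - g (snd z) - M (fst z - snd z)) + (f (fst z) - f a) * M (fst z - snd z)) +
      (g (snd z) * (f (fst z) - f (snd z) - L (fst z - snd z)) + (g (snd z) - g a) * L (fst z - snd z)))
     = (\<lambda>z. f (fst z) * g (fst z) - f (snd z) * g (snd z) - (f a * M (fst z - snd z) + L (fst z - snd z) * g a))"
    by (simp add: fun_eq_iff algebra_simps)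
  finally show ?thesis
    using bl c unfolding strict_diff_def
    by (auto intro!: bounded_linear_add bounded_linear_const_mult bounded_linear_mult_const)
qed

text \<open>Based on \<open>1/f x - 1/f y = - (f x - f y) / (f x * f y)\<close>. This may fail where
  \<open>f\<close> vanishes, so the expressions are identified only near
  \<open>(a, a)\<close>.\<close>

lemma strict_diff_inverse:
  assumes f: "strict_diff f L a" and "f a \<noteq> 0"
  shows "strict_diff (\<lambda>x. inverse (f x)) (\<lambda>d. - (L d * inverse (f a) * inverse (f a))) a"
proof -
  let ?N = "\<lambda>z. of_real (norm (fst z - snd z)) :: complex"
  have bl: "bounded_linear L" and c: "isCont f a"
    and o: "(\<lambda>z. f (fst z) - f (snd z) - L (fst z - snd z)) \<in> o[nhds (a, a)](?N)"
    using f by (auto simp: strict_diff_def)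
  define g where "g x = inverse (f x)" for x
  have g: "isCont g a"
    unfolding g_def using c \<open>f a \<noteq> 0\<close> by (intro continuous_intros) auto
  note gl = isCont_fst_snd_smallo[OF g]
  have "(\<lambda>z. (g (fst z) * g (snd z)) * (f (fst z) - f (snd z) - L (fst z - snd z))) \<in> o[nhds (a, a)](\<lambda>z. (1 * 1) * ?N z)"
    by (intro landau_o.big_small_mult[OF landau_o.big_mult[OF gl(3,4)] o])
  moreover have "(\<lambda>z. (g (fst z) * (g (snd z) - g a)) * L (fst z - snd z)) \<in> o[nhds (a, a)](\<lambda>z. (1 * 1) * ?N z)"
    by (intro landau_o.small_big_mult[OF landau_o.big_small_mult[OF gl(3,2)] bounded_linear_bigo[OF bl]])
  moreover have "(\<lambda>z. ((g (fst z) - g a) * g a) * L (fst z - snd z)) \<in> o[nhds (a, a)](\<lambda>z. (1 * 1) * ?N z)"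
    by (intro landau_o.small_big_mult[OF landau_o.small_big_mult[OF gl(1)] bounded_linear_bigo[OF bl]]) simp
  ultimately have "(\<lambda>z. - ((g (fst z) * g (snd z)) * (f (fst z) - f (snd z) - L (fst z - snd z)) +
      ((g (fst z) * (g (snd z) - g a)) * L (fst z - snd z) + ((g (fst z) - g a) * g a) * L (fst z - snd z))))
      \<in> o[nhds (a, a)](\<lambda>z. (1 * 1) * ?N z)"
    unfolding landau_o.small.uminus_in_iff by (intro sum_in_smallo)
  also have "?this \<longleftrightarrow> (\<lambda>z. g (fst z) - g (snd z) - - (L (fst z - snd z) * g a * g a)) \<in> o[nhds (a, a)](\<lambda>z. (1 * 1) * ?N z)"
  proof (rule landau_o.small.in_cong)
    have "eventually (\<lambda>x. f x \<noteq> 0) (nhds a)"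
      using c \<open>f a \<noteq> 0\<close> tendsto_imp_eventually_ne[of f "f a" "nhds a" 0]
      by (simp add: continuous_at tendsto_at_iff_tendsto_nhds)
    then have "eventually (\<lambda>z. f (fst z) \<noteq> 0 \<and> f (snd z) \<noteq> 0) (nhds (a, a))"
      unfolding nhds_prod by (auto simp: eventually_prod_filter)
    then show "eventually (\<lambda>z. - ((g (fst z) * g (snd z)) * (f (fst z) - f (snd z) - L (fst z - snd z)) +
      ((g (fst z) * (g (snd z) - g a)) * L (fst z - snd z) + ((g (fst z) - g a) * g a) * L (fst z - snd z)))
      = g (fst z) - g (snd z) - - (L (fst z - snd z) * g a * g a)) (nhds (a, a))"
      by (rule eventually_mono) (use \<open>f a \<noteq> 0\<close> in \<open>simp add: g_def field_simps\<close>)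
  qed
  finally show ?thesis
    using bl g unfolding strict_diff_def g_def
    by (auto intro!: bounded_linear_minus bounded_linear_mult_const)
qed

lemma strict_diff_minus:
  assumes "strict_diff f L a"
  shows "strict_diff (\<lambda>x. - f x) (\<lambda>d. - L d) a"
  using strict_diff_mult[OF strict_diff_const[of "-1"] assms] by simp

lemma strict_diff_diff:
  assumes "strict_diff f L a" "strict_diff g M a"
  shows "strict_diff (\<lambda>x. f x - g x) (\<lambda>d. L d - M d) a"
  using strict_diff_add[OF assms(1) strict_diff_minus[OF assms(2)]] by simp

lemma strict_diff_divide:
  assumes "strict_diff f L a" "strict_diff g M a" "g a \<noteq> 0"
  shows "strict_diff (\<lambda>x. f x / g x) (\<lambda>d. (L d * g a - f a * M d) / (g a * g a)) a"
proof -
  have "(\<lambda>d. f a * - (M d * inverse (g a) * inverse (g a)) + L d * inverse (g a)) =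
      (\<lambda>d. (L d * g a - f a * M d) / (g a * g a))"
    using assms(3) by (simp add: fun_eq_iff field_simps)
  with strict_diff_mult[OF assms(1) strict_diff_inverse[OF assms(2,3)]] show ?thesis
    by (simp add: divide_inverse)
qed

lemma strict_diffD:
  assumes "strict_diff f L a" "\<eta> > 0"
  obtains \<rho> where "\<rho> > 0"
    "\<And>x y. norm (x - a) < \<rho> \<Longrightarrow> norm (y - a) < \<rho> \<Longrightarrow> norm (f x - f y - L (x - y)) \<le> \<eta> * norm (x - y)"
proof -
  have "eventually (\<lambda>z. norm (f (fst z) - f (snd z) - L (fst z - snd z)) \<le> \<eta> * norm (of_real (norm (fst z - snd z)) :: complex)) (nhds (a, a))"
    using assms by (intro landau_o.smallD) (auto simp: strict_diff_def)
  then obtain P Q where PQ: "eventually P (nhds a)" "eventually Q (nhds a)"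
    "\<And>x y. P x \<Longrightarrow> Q y \<Longrightarrow> norm (f x - f y - L (x - y)) \<le> \<eta> * norm (x - y)"
    unfolding nhds_prod eventually_prod_filter by auto
  from eventually_conj[OF PQ(1,2)] obtain \<rho> where "\<rho> > 0" "\<And>x. dist x a < \<rho> \<Longrightarrow> P x \<and> Q x"
    unfolding eventually_nhds_metric by auto
  then show thesis
    using PQ(3) that by (auto simp: dist_norm)
qed

section \<open>The Helfrich nonlinearity near the cylinder\<close>

text \<open>The equation multiplied by \<open>2 (1 + u'\<^sup>2)\<^bsup>5/2\<^esup>\<close> is rational in \<open>u, \<dots>, u''''\<close>; this is its solution for
  \<open>u''''\<close>. Here \<open>q = 1 + u'\<^sup>2\<close>, \<open>h = q\<^bsup>3/2\<^esup> H\<close>, and \<open>h'\<close> is the \<open>x\<close>-derivative of \<open>h\<close>.\<close>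
definition helfrich_rhs :: "'a::field \<Rightarrow> 'a \<Rightarrow> 'a \<Rightarrow> 'a \<Rightarrow> 'a \<Rightarrow> 'a" where
  "helfrich_rhs e u p s t =
    (let q = 1 + p * p; h = (q / u - s) / 2; h' = (2 * p * s / u - q * p / (u * u) - t) / 2 in
     2 * s * s / u + 2 * p * t / u - 2 * p * p * s / (u * u) - (2 * p * p * s + q * s) / (u * u)
     + 2 * q * p * p / (u * u * u) + 2 * (p / u) * (h' - 3 * p * s * h / q) - 14 * p * s * h' / q
     - 6 * (s * s + p * t) * h / q + 36 * p * p * s * s * h / (q * q)
     + h * (s + q / u) * (s + q / u) / (q * q) - 4 * e * q * h)"

text \<open>The right-hand side of \<open>v'''' + v/\<alpha>^4 = ...\<close> for
  \<open>v = u - \<alpha>\<close>.\<close>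

definition nonlin :: "real \<Rightarrow> complex \<Rightarrow> complex \<Rightarrow> complex \<Rightarrow> complex \<Rightarrow> complex \<Rightarrow> complex" where
  "nonlin \<alpha> e v p s t = helfrich_rhs e (of_real \<alpha> + v) p s t + v / of_real (\<alpha>^4)"

text \<open>For constant \<open>u\<close> only \<open>h/\<alpha>^2 - 4 e h\<close> with
  \<open>h = 1/(2 \<alpha>)\<close> survives. This is the defect of the cylinder, which the radius
  in \<open>e\<close> has to keep small.\<close>

lemma nonlin_at_0:
  assumes "\<alpha> \<noteq> 0"
  shows "nonlin \<alpha> e 0 0 0 0 = - (2 / of_real \<alpha>) * (e - of_real (1 / (4 * \<alpha>^2)))"
  using assms by (simp add: nonlin_def helfrich_rhs_def field_simps power2_eq_square)

text \<open>For even \<open>u\<close> the odd derivatives \<open>p\<close> and \<open>t\<close>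
  change sign under reflection; this carries evenness through the iteration.\<close>

lemma nonlin_even: "nonlin \<alpha> e v (- p) s (- t) = nonlin \<alpha> e v p s t"
  by (simp add: nonlin_def helfrich_rhs_def Let_def algebra_simps diff_divide_distrib)

lemma nonlin_real:
  assumes "e \<in> \<real>" "v \<in> \<real>" "p \<in> \<real>" "s \<in> \<real>" "t \<in> \<real>"
  shows "nonlin \<alpha> e v p s t \<in> \<real>"
  unfolding nonlin_def helfrich_rhs_def Let_def
  by (intro Reals_add Reals_diff Reals_mult Reals_divide Reals_of_real Reals_numeral Reals_1 assms)

lemma sep_holomorphic_nonlin:
  assumes "sep_holomorphic v S T" "sep_holomorphic p S T" "sep_holomorphic s S T" "sep_holomorphic t S T"
    and "\<alpha> \<noteq> 0" "\<And>e x. e \<in> S \<Longrightarrow> x \<in> T \<Longrightarrow> of_real \<alpha> + v e x \<noteq> 0"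
    "\<And>e x. e \<in> S \<Longrightarrow> x \<in> T \<Longrightarrow> 1 + p e x * p e x \<noteq> 0"
  shows "sep_holomorphic (\<lambda>e x. nonlin \<alpha> e (v e x) (p e x) (s e x) (t e x)) S T"
proof -
  have "sep_holomorphic (\<lambda>e x. e) S T"
    by (intro sep_holomorphic_const_snd holomorphic_intros)
  then show ?thesis
    unfolding nonlin_def helfrich_rhs_def Let_def
    by (intro sep_holomorphic_intros assms(1-4)) (use assms(5-) in auto)
qed

text \<open>The linearisation at the cylinder is \<open>v'''' + v / \<alpha>\<^sup>4\<close>, so \<open>nonlin\<close> has no first-order part in the
  unknowns.\<close>
lemma nonlin_strict_diff:
  assumes "\<alpha> \<noteq> 0"
  shows "strict_diff (\<lambda>z. nonlin \<alpha> (fst z) (fst (snd z)) (fst (snd (snd z))) (fst (snd (snd (snd z)))) (snd (snd (snd (snd z)))))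
    (\<lambda>d. - (2 / of_real \<alpha>) * fst d) (of_real (1 / (4 * \<alpha>^2)), 0, 0, 0, 0)" (is "strict_diff ?f ?L ?a")
proof -
  define a :: "complex \<times> complex \<times> complex \<times> complex \<times> complex" where "a = ?a"
  note bl = bounded_linear_fst_comp bounded_linear_snd_comp bounded_linear_ident
  have lin: "strict_diff (\<lambda>z. fst z) (\<lambda>z. fst z) a"
    "strict_diff (\<lambda>z. fst (snd z)) (\<lambda>z. fst (snd z)) a"
    "strict_diff (\<lambda>z. fst (snd (snd z))) (\<lambda>z. fst (snd (snd z))) a"
    "strict_diff (\<lambda>z. fst (snd (snd (snd z)))) (\<lambda>z. fst (snd (snd (snd z)))) a"
    "strict_diff (\<lambda>z. snd (snd (snd (snd z)))) (\<lambda>z. snd (snd (snd (snd z)))) a"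
    by (intro strict_diff_linear bl)+
  \<comment> \<open>Leaves the derivative open while the rules assemble it; only the finished
    expression is compared with the stated one.\<close>
  have cong: "strict_diff f L' a" if "strict_diff f L a" "L = L'" for f L L'
    using that by simp
  show ?thesis
    unfolding a_def[symmetric] nonlin_def helfrich_rhs_def Let_def
    by (rule cong, (rule strict_diff_add strict_diff_diff strict_diff_mult strict_diff_divide strict_diff_const lin |
          (use assms in \<open>simp add: a_def; fail\<close>))+)
       (use assms in \<open>simp add: a_def fun_eq_iff field_simps power2_eq_square power4_eq_xxxx\<close>)
qed

section \<open>From the explicit ODE to the Helfrich equation\<close>

text \<open>The concluding algebra, with \<open>q\<close>, \<open>h\<close>, \<open>h'\<close>,
  \<open>h''\<close> as independent letters and \<open>k\<close> standing for
  \<open>u'' + q/u\<close>, so that only \<open>u\<close> and \<open>q\<close> occur as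
  denominators.\<close>

lemma helfrich_rhs_cancels:
  fixes e u p s t q h h' k :: real
  assumes "u \<noteq> 0" "q \<noteq> 0"
    and rest: "2 * h'' = - (2 * (p / u) * (h' - 3 * p * s * h / q) - 14 * p * s * h' / q
     - 6 * (s * s + p * t) * h / q + 36 * p * p * s * s * h / (q * q) + h * k * k / (q * q) - 4 * e * q * h)"
  shows "1 / u * (p * (q * h' - 3 * p * s * h) / q^3 +
      u * ((q * h'' - p * s * h' - 3 * (s * s + p * t) * h) / q^3 - 6 * p * s * (q * h' - 3 * p * s * h) / q^4))
      + 1/2 * h * k^2 / q^4 - 2 * e * h / q = 0"
proof -
  have eq: "h'' = - (2 * (p / u) * (h' - 3 * p * s * h / q) - 14 * p * s * h' / q
     - 6 * (s * s + p * t) * h / q + 36 * p * p * s * s * h / (q * q) + h * k * k / (q * q) - 4 * e * q * h) / 2"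
    using rest by simp
  show ?thesis
    unfolding eq using assms(1,2) by (simp add: field_simps power2_eq_square power3_eq_cube power4_eq_xxxx)
qed

text \<open>Roots occur only as powers of \<open>r = sqrt q\<close>: \<open>H = h / r^3\<close>,
  \<open>H' = b / r^5\<close>, and the flux \<open>u H' / r\<close> is the root-free
  \<open>u b / q^3\<close>. The whole left-hand side is then a rational expression times
  \<open>1/r\<close>.\<close>

lemma helfrich_eq_if_ode:
  fixes u0 u1 u2 u3 :: "real \<Rightarrow> real"
  assumes J: "open J"
    and d: "\<And>x. x \<in> J \<Longrightarrow> (u0 has_real_derivative u1 x) (at x)"
      "\<And>x. x \<in> J \<Longrightarrow> (u1 has_real_derivative u2 x) (at x)"
      "\<And>x. x \<in> J \<Longrightarrow> (u2 has_real_derivative u3 x) (at x)"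
      "\<And>x. x \<in> J \<Longrightarrow> (u3 has_real_derivative helfrich_rhs e (u0 x) (u1 x) (u2 x) (u3 x)) (at x)"
    and pos: "\<And>x. x \<in> J \<Longrightarrow> u0 x > 0" and x: "x \<in> J"
  shows "helfrich_eq e u0 x"
proof -
  \<comment> \<open>\<open>deriv u0\<close> is known only on \<open>J\<close>, so nested occurrences
    of \<open>deriv\<close> are replaced on the open set \<open>J\<close> before differentiating
    again.\<close>
  have deriv_eqI: "deriv f y = g' y" if "\<And>y. y \<in> J \<Longrightarrow> f y = g y"
    "\<And>y. y \<in> J \<Longrightarrow> (g has_real_derivative g' y) (at y)" "y \<in> J" for f g g' :: "real \<Rightarrow> real" and y
    by (rule DERIV_imp_deriv, rule has_field_derivative_transform_within_open[OF that(2)[OF that(3)] J that(3)])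
       (use that(1) in simp)
  define q where "q y = 1 + u1 y * u1 y" for y
  define r where "r y = sqrt (q y)" for y
  define h where "h y = (q y / u0 y - u2 y) / 2" for y
  define h' where "h' y = (2 * u1 y * u2 y / u0 y - q y * u1 y / (u0 y * u0 y) - u3 y) / 2" for y
  \<comment> \<open>\<open>helfrich_rhs\<close> stands in for \<open>u''''\<close>. Its leading
    summands are the ones written here, so \<open>2 h''\<close> reduces to the negative of its
    remaining summands.\<close>
  define h'' where "h'' y = (2 * u2 y * u2 y / u0 y + 2 * u1 y * u3 y / u0 y - 2 * u1 y * u1 y * u2 y / (u0 y * u0 y)
     - (2 * u1 y * u1 y * u2 y + q y * u2 y) / (u0 y * u0 y) + 2 * q y * u1 y * u1 y / (u0 y * u0 y * u0 y)
     - helfrich_rhs e (u0 y) (u1 y) (u2 y) (u3 y)) / 2" for y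
  define b where "b y = q y * h' y - 3 * u1 y * u2 y * h y" for y
  have q: "q y > 0" for y
    by (simp add: q_def add_pos_nonneg)
  have r: "r y > 0" "r y * r y = q y" for y
    using q[of y] by (auto simp: r_def)
  have dq: "(q has_real_derivative 2 * u1 y * u2 y) (at y)" if "y \<in> J" for y
    unfolding q_def[abs_def] by (rule derivative_eq_intros d that refl)+ simp
  have dr: "(r has_real_derivative u1 y * u2 y / r y) (at y)" if "y \<in> J" for y
    unfolding r_def[abs_def] using DERIV_chain2[OF DERIV_real_sqrt[OF q[of y]] dq[OF that]]
    by (rule DERIV_cong) (use q[of y] in \<open>simp add: field_simps\<close>)
  have dh: "(h has_real_derivative h' y) (at y)" if "y \<in> J" for y
    unfolding h_def[abs_def] h'_def using pos[OF that]
    by (auto intro!: derivative_eq_intros d dq that) (simp add: field_simps)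
  have dh': "(h' has_real_derivative h'' y) (at y)" if "y \<in> J" for y
    unfolding h'_def[abs_def] h''_def using pos[OF that]
    by (auto intro!: derivative_eq_intros d dq that) (simp add: field_simps)
  have u1: "deriv u0 y = u1 y" if "y \<in> J" for y
    by (rule deriv_eqI) (use d that in auto)
  have u2: "deriv (deriv u0) y = u2 y" if "y \<in> J" for y
    by (rule deriv_eqI[of _ u1]) (use d that u1 in auto)
  have sq: "sqrt (1 + (deriv u0 y)\<^sup>2) = r y" if "y \<in> J" for y
    using u1[OF that] by (simp add: r_def q_def power2_eq_square)
  have H: "mean_curv u0 y = h y / r y ^ 3" if "y \<in> J" for y
    unfolding mean_curv_def sq[OF that] u2[OF that] h_def r(2)[symmetric]
    using r(1)[of y] pos[OF that] by (simp add: field_simps power3_eq_cube)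
  have dH: "((\<lambda>y. h y / r y ^ 3) has_real_derivative b y / r y ^ 5) (at y)" if "y \<in> J" for y
  proof -
    have "((\<lambda>y. h y / r y ^ 3) has_real_derivative
        (h' y * r y ^ 3 - h y * (3 * r y ^ 2 * (u1 y * u2 y / r y))) / (r y ^ 3 * r y ^ 3)) (at y)"
      using r(1)[of y] by (auto intro!: derivative_eq_intros dh dr that)
    then show ?thesis
      by (rule DERIV_cong)
         (use r(1)[of y] in \<open>simp add: b_def r(2)[symmetric] field_simps eval_nat_numeral\<close>)
  qed
  have H': "deriv (mean_curv u0) y = b y / r y ^ 5" if "y \<in> J" for y
    by (rule deriv_eqI[OF H dH that])
  have db: "(b has_real_derivative q y * h'' y - u1 y * u2 y * h' y - 3 * (u2 y * u2 y + u1 y * u3 y) * h y) (at y)"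
    if "y \<in> J" for y
    unfolding b_def[abs_def]
    by (auto intro!: derivative_eq_intros d dq dh dh' that simp: algebra_simps)
  have B: "u0 y / sqrt (1 + (deriv u0 y)\<^sup>2) * deriv (mean_curv u0) y = u0 y * (b y / q y ^ 3)" if "y \<in> J" for y
    unfolding sq[OF that] H'[OF that] r(2)[symmetric] using r(1)[of y]
    by (simp add: field_simps eval_nat_numeral)
  have dB: "((\<lambda>y. u0 y * (b y / q y ^ 3)) has_real_derivative
      u1 y * b y / q y ^ 3 + u0 y * ((q y * h'' y - u1 y * u2 y * h' y - 3 * (u2 y * u2 y + u1 y * u3 y) * h y) / q y ^ 3
        - 6 * u1 y * u2 y * b y / q y ^ 4)) (at y)" if "y \<in> J" for y
  proof -
    have "((\<lambda>y. b y / q y ^ 3) has_real_derivative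
        ((q y * h'' y - u1 y * u2 y * h' y - 3 * (u2 y * u2 y + u1 y * u3 y) * h y) * q y ^ 3
          - b y * (3 * q y ^ 2 * (2 * u1 y * u2 y))) / (q y ^ 3 * q y ^ 3)) (at y)"
      using q[of y] by (auto intro!: derivative_eq_intros db dq that)
    from DERIV_mult[OF d(1)[OF that] this] show ?thesis
      by (rule DERIV_cong) (use q[of y] in \<open>simp add: field_simps eval_nat_numeral\<close>)
  qed
  have "deriv (\<lambda>y. u0 y / sqrt (1 + (deriv u0 y)\<^sup>2) * deriv (mean_curv u0) y) x =
      u1 x * b x / q x ^ 3 + u0 x * ((q x * h'' x - u1 x * u2 x * h' x - 3 * (u2 x * u2 x + u1 x * u3 x) * h x) / q x ^ 3
        - 6 * u1 x * u2 x * b x / q x ^ 4)"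
    by (rule deriv_eqI[OF B dB x])
  moreover define k where "k = u2 x + q x / u0 x"
  have "2 * h'' x = - (2 * (u1 x / u0 x) * (h' x - 3 * u1 x * u2 x * h x / q x) - 14 * u1 x * u2 x * h' x / q x
     - 6 * (u2 x * u2 x + u1 x * u3 x) * h x / q x + 36 * u1 x * u1 x * u2 x * u2 x * h x / (q x * q x)
     + h x * k * k / (q x * q x) - 4 * e * q x * h x)"
    unfolding h''_def helfrich_rhs_def Let_def q_def[symmetric] h_def[symmetric] h'_def[symmetric] k_def by (simp add: mult.commute)
  then have "1 / u0 x * (u1 x * (q x * h' x - 3 * u1 x * u2 x * h x) / q x^3 +
      u0 x * ((q x * h'' x - u1 x * u2 x * h' x - 3 * (u2 x * u2 x + u1 x * u3 x) * h x) / q x^3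
        - 6 * u1 x * u2 x * (q x * h' x - 3 * u1 x * u2 x * h x) / q x^4))
      + 1/2 * h x * k^2 / q x^4 - 2 * e * h x / q x = 0"
    by (rule helfrich_rhs_cancels[rotated 2]) (use pos[OF x] q[of x] in auto)
  moreover have "deriv (deriv u0) x / r x ^ 3 + 1 / (u0 x * r x) = k / r x ^ 3"
    unfolding u2[OF x] k_def r(2)[symmetric] using r(1)[of x] pos[OF x] by (simp add: field_simps power3_eq_cube)
  moreover define Q where "Q = u1 x * b x / q x ^ 3 + u0 x * ((q x * h'' x - u1 x * u2 x * h' x - 3 * (u2 x * u2 x + u1 x * u3 x) * h x) / q x ^ 3
        - 6 * u1 x * u2 x * b x / q x ^ 4)"
  ultimately have "1 / u0 x * Q + 1/2 * h x * k^2 / q x^4 - 2 * e * h x / q x = 0"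
    and eq: "helfrich_eq e u0 x \<longleftrightarrow> 1 / (u0 x * r x) * Q + 1/2 * (h x / r x ^ 3) * (k / r x ^ 3)^2 - 2 * e * (h x / r x ^ 3) = 0"
    unfolding helfrich_eq_def sq[OF x] H[OF x] by (simp_all add: b_def)
  moreover have "1 / (u0 x * r x) * Q + 1/2 * (h x / r x ^ 3) * (k / r x ^ 3)^2 - 2 * e * (h x / r x ^ 3)
      = (1 / u0 x * Q + 1/2 * h x * k^2 / q x^4 - 2 * e * h x / q x) / r x"
    unfolding r(2)[symmetric] using r(1)[of x] pos[OF x] by (simp add: field_simps eval_nat_numeral)
  ultimately show ?thesis by simp
qed

section \<open>The fixed point\<close>

text \<open>Banach's iteration with pointwise bounds on \<open>A\<close> in place of a metric on a
  function space. \<open>P\<close> gathers the properties that survive both \<open>\<Phi>\<close>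
  and uniform limits.\<close>

lemma uniform_contraction_fixpoint:
  fixes \<Phi> :: "('a \<Rightarrow> 'b::banach) \<Rightarrow> 'a \<Rightarrow> 'b"
  assumes P0: "P f0" and step: "\<And>f. P f \<Longrightarrow> P (\<Phi> f)"
    and bd: "\<And>x. x \<in> A \<Longrightarrow> norm (\<Phi> f0 x - f0 x) \<le> d0"
    and contr: "\<And>f g d x. P f \<Longrightarrow> P g \<Longrightarrow> (\<And>y. y \<in> A \<Longrightarrow> norm (f y - g y) \<le> d) \<Longrightarrow> x \<in> A \<Longrightarrow>
      norm (\<Phi> f x - \<Phi> g x) \<le> d / 2"
    and closed: "\<And>F f. (\<And>n. P (F n)) \<Longrightarrow> uniform_limit A F f sequentially \<Longrightarrow> P f"
  shows "\<exists>f. P f \<and> (\<forall>x\<in>A. \<Phi> f x = f x)"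
proof -
  define F where "F n = (\<Phi> ^^ n) f0" for n
  have P: "P (F n)" for n
    by (induction n) (auto simp: F_def P0 step)
  have diff: "norm (F (Suc n) x - F n x) \<le> d0 * (1 / 2) ^ n" if "x \<in> A" for n x
    using that
  proof (induction n arbitrary: x)
    case 0
    then show ?case using bd by (simp add: F_def)
  next
    case (Suc n)
    have "norm (\<Phi> (F (Suc n)) x - \<Phi> (F n) x) \<le> (d0 * (1 / 2) ^ n) / 2"
      by (rule contr[OF P P Suc.IH Suc.prems])
    then show ?case by (simp add: F_def)
  qed
  \<comment> \<open>Up to the initial term, the iterates are partial sums of a telescoping series
    with a geometric majorant.\<close>
  have "uniform_limit A (\<lambda>n x. \<Sum>i<n. F (Suc i) x - F i x) (\<lambda>x. \<Sum>i. F (Suc i) x - F i x) sequentially"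
    by (rule Weierstrass_m_test[OF diff]) (auto intro!: summable_mult summable_geometric)
  moreover have "(\<lambda>n x. \<Sum>i<n. F (Suc i) x - F i x) = (\<lambda>n x. F n x - F 0 x)"
    by (intro ext) (rule sum_lessThan_telescope[of "\<lambda>i. F i _"])
  ultimately have "uniform_limit A (\<lambda>n x. F n x - F 0 x) (\<lambda>x. \<Sum>i. F (Suc i) x - F i x) sequentially"
    by (simp only:)
  then have "uniform_limit A (\<lambda>n x. F n x - F 0 x + F 0 x) (\<lambda>x. (\<Sum>i. F (Suc i) x - F i x) + F 0 x) sequentially"
    by (intro uniform_limit_add uniform_limit_const)
  then obtain g where lim: "uniform_limit A F g sequentially"
    by simp
  have g: "P g" by (rule closed[OF P lim])
  have "\<Phi> g x = g x" if x: "x \<in> A" for x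
  proof -
    have "norm (\<Phi> g x - g x) \<le> e" if "e > 0" for e
    proof -
      from uniform_limitD[OF lim, of "e / 2"] \<open>e > 0\<close> obtain n where n: "\<And>m y. m \<ge> n \<Longrightarrow> y \<in> A \<Longrightarrow> dist (F m y) (g y) < e / 2"
        unfolding eventually_sequentially by auto
      have "norm (\<Phi> g x - \<Phi> (F n) x) \<le> (e / 2) / 2"
        by (rule contr[OF g P _ x]) (use n[of n] in \<open>auto simp: dist_norm norm_minus_commute less_imp_le\<close>)
      moreover have "norm (F (Suc n) x - g x) < e / 2"
        using n[of "Suc n" x] x by (simp add: dist_norm)
      moreover have "norm (\<Phi> g x - g x) \<le> norm (\<Phi> g x - \<Phi> (F n) x) + norm (F (Suc n) x - g x)"
        using norm_triangle_ineq[of "\<Phi> g x - \<Phi> (F n) x" "F (Suc n) x - g x"] by (simp add: F_def)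
      ultimately show ?thesis using \<open>e > 0\<close> by simp
    qed
    then have "norm (\<Phi> g x - g x) \<le> 0" by (rule field_le_epsilon) auto
    then show ?thesis by simp
  qed
  with g show ?thesis by blast
qed

lemma sup_bounded_mono:
  assumes "sup_bounded R T C" "C \<le> C'"
  shows "sup_bounded R T C'"
  unfolding sup_bounded_def
proof (intro conjI allI impI)
  show "C' \<ge> 0" using assms sup_bounded_nonneg by force
  fix g :: "complex \<Rightarrow> complex" and M :: real and x :: complex
  assume *: "g holomorphic_on ball 0 R" "\<forall>y\<in>ball 0 R. norm (g y) \<le> M" "x \<in> ball 0 R"
  then have "norm (g x) \<le> M" by blast
  then have "M \<ge> 0" using norm_ge_zero[of "g x"] by linarith
  have "norm (T g x) \<le> C * M" using sup_boundedD[OF assms(1)] * by blast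
  also have "\<dots> \<le> C' * M" using assms(2) \<open>M \<ge> 0\<close> by (rule mult_right_mono)
  finally show "norm (T g x) \<le> C' * M" .
qed

lemma clamped_bounded_common:
  assumes "1 < R"
  obtains C where "C > 0" "\<And>m. m < 4 \<Longrightarrow> sup_bounded R (clamped k m) C"
proof -
  from clamped_bounded[OF assms, of k] obtain c where c: "\<And>m. sup_bounded R (clamped k m) (c m)"
    by metis
  show thesis
  proof (rule that)
    \<comment> \<open>The summand 1 makes the constant positive, since it is divided by
      later.\<close>
    show "1 + (\<Sum>m<4. c m) > 0"
      using c[THEN sup_bounded_nonneg] by (intro add_pos_nonneg sum_nonneg) auto
    show "sup_bounded R (clamped k m) (1 + (\<Sum>m<4. c m))" if "m < 4" for m
      using c[THEN sup_bounded_nonneg] that member_le_sum[of m "{..<4}" c]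
      by (intro sup_bounded_mono[OF c]) auto
  qed
qed

text \<open>Both arguments share \<open>e\<close>, and the derivative in
  \<open>nonlin_strict_diff\<close> acts on \<open>e\<close> alone, so it drops out of the
  difference and only the small remainder is left.\<close>

lemma nonlin_lipschitz:
  assumes "\<alpha> \<noteq> 0" "\<eta> > 0"
  obtains \<rho> where "\<rho> > 0"
    "\<And>e v p s t v' p' s' t'. norm (e - of_real (1 / (4 * \<alpha>^2))) + (norm v + norm p + norm s + norm t) < \<rho> \<Longrightarrow>
       norm (e - of_real (1 / (4 * \<alpha>^2))) + (norm v' + norm p' + norm s' + norm t') < \<rho> \<Longrightarrow>
       norm (nonlin \<alpha> e v p s t - nonlin \<alpha> e v' p' s' t')
         \<le> \<eta> * (norm (v - v') + norm (p - p') + norm (s - s') + norm (t - t'))"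
proof -
  let ?a = "(of_real (1 / (4 * \<alpha>^2)), 0, 0, 0, 0) :: complex \<times> complex \<times> complex \<times> complex \<times> complex"
  from strict_diffD[OF nonlin_strict_diff[OF assms(1)] assms(2)] obtain \<rho> where \<rho>: "\<rho> > 0"
    "\<And>x y. norm (x - ?a) < \<rho> \<Longrightarrow> norm (y - ?a) < \<rho> \<Longrightarrow>
      norm (nonlin \<alpha> (fst x) (fst (snd x)) (fst (snd (snd x))) (fst (snd (snd (snd x)))) (snd (snd (snd (snd x))))
        - nonlin \<alpha> (fst y) (fst (snd y)) (fst (snd (snd y))) (fst (snd (snd (snd y)))) (snd (snd (snd (snd y))))
        - - (2 / of_real \<alpha>) * fst (x - y)) \<le> \<eta> * norm (x - y)"
    by blast
  have norm5: "norm (e, v, p, s, t) \<le> norm e + (norm v + norm p + norm s + norm t)" for e v p s t :: complex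
    using norm_Pair_le[of e "(v, p, s, t)"] norm_Pair_le[of v "(p, s, t)"] norm_Pair_le[of p "(s, t)"] norm_Pair_le[of s t]
    by linarith
  show thesis
  proof (rule that[OF \<rho>(1)])
    fix e v p s t v' p' s' t' :: complex
    assume "norm (e - of_real (1 / (4 * \<alpha>^2))) + (norm v + norm p + norm s + norm t) < \<rho>"
      "norm (e - of_real (1 / (4 * \<alpha>^2))) + (norm v' + norm p' + norm s' + norm t') < \<rho>"
    then have "norm ((e, v, p, s, t) - ?a) < \<rho>" "norm ((e, v', p', s', t') - ?a) < \<rho>"
      using norm5[of "e - of_real (1 / (4 * \<alpha>^2))" v p s t] norm5[of "e - of_real (1 / (4 * \<alpha>^2))" v' p' s' t'] by simp_all
    from \<rho>(2)[OF this]
    have "norm (nonlin \<alpha> e v p s t - nonlin \<alpha> e v' p' s' t') \<le> \<eta> * norm (0 :: complex, v - v', p - p', s - s', t - t')"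
      by simp
    also have "\<dots> \<le> \<eta> * (norm (v - v') + norm (p - p') + norm (s - s') + norm (t - t'))"
      using norm5[of 0 "v - v'" "p - p'" "s - s'" "t - t'"] assms(2) by (intro mult_left_mono) auto
    finally show "norm (nonlin \<alpha> e v p s t - nonlin \<alpha> e v' p' s' t')
         \<le> \<eta> * (norm (v - v') + norm (p - p') + norm (s - s') + norm (t - t'))" .
  qed
qed

text \<open>The invariant of the iteration. Functions are uncurried because convergence is uniform
  on \<open>S \<times> T\<close>.\<close>

definition admissible :: "complex set \<Rightarrow> complex set \<Rightarrow> real \<Rightarrow> (complex \<times> complex \<Rightarrow> complex) \<Rightarrow> bool" where
  "admissible S T M f \<longleftrightarrow> sep_holomorphic (\<lambda>e x. f (e, x)) S T \<and>
     (\<forall>e\<in>S. \<forall>x\<in>T. norm (f (e, x)) \<le> M \<and> f (e, - x) = f (e, x) \<and> (e \<in> \<real> \<longrightarrow> x \<in> \<real> \<longrightarrow> f (e, x) \<in> \<real>))"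

lemma admissible_uniform_limit:
  assumes F: "\<And>n. admissible S T M (F n)" and lim: "uniform_limit (S \<times> T) F f sequentially"
    and ST: "open S" "open T" "\<And>x. x \<in> T \<Longrightarrow> - x \<in> T"
  shows "admissible S T M f"
  unfolding admissible_def
proof (intro conjI ballI impI)
  show "sep_holomorphic (\<lambda>e x. f (e, x)) S T"
    using sep_holomorphic_uniform_limit[OF _ ST(1,2) lim] F by (simp add: admissible_def)
  fix e x assume ex: "e \<in> S" "x \<in> T"
  have pt: "(\<lambda>n. F n (e, y)) \<longlonglongrightarrow> f (e, y)" if "y \<in> T" for y
    using tendsto_uniform_limitI[OF lim] ex that by simp
  show "norm (f (e, x)) \<le> M"
    by (rule Lim_norm_ubound[OF _ pt[OF ex(2)]]) (use F ex in \<open>auto simp: admissible_def\<close>)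
  have "(\<lambda>n. F n (e, - x)) = (\<lambda>n. F n (e, x))"
    using F ex by (auto simp: admissible_def)
  then show "f (e, - x) = f (e, x)"
    using LIMSEQ_unique[OF pt[OF ST(3)[OF ex(2)]]] pt[OF ex(2)] by simp
  show "f (e, x) \<in> \<real>" if "e \<in> \<real>" "x \<in> \<real>"
    by (rule closed_sequentially[OF closed_complex_Reals _ pt[OF ex(2)]]) (use F ex that in \<open>auto simp: admissible_def\<close>)
qed

section \<open>The fixed point for the Helfrich problem\<close>

text \<open>Only the equation \<open>f = N(e, G f)\<close> is solved here, for any \<open>k\<close>;
  the relation \<open>4 k^4 = 1/\<alpha>^4\<close>, which turns it into the differential equation,
  enters in the theorem.\<close>

lemma holomorphic_solution_family:
  assumes "\<alpha> > 0"
  obtains r f where "r > 0" "sep_holomorphic f (ball (of_real (1 / (4 * \<alpha>^2))) r) (ball 0 2)"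
    "\<And>e x. e \<in> ball (of_real (1 / (4 * \<alpha>^2))) r \<Longrightarrow> x \<in> ball 0 2 \<Longrightarrow> norm (clamped k 0 (f e) x) < \<alpha> \<and>
       f e x = nonlin \<alpha> e (clamped k 0 (f e) x) (clamped k 1 (f e) x) (clamped k 2 (f e) x) (clamped k 3 (f e) x) \<and>
       f e (- x) = f e x \<and> (e \<in> \<real> \<longrightarrow> x \<in> \<real> \<longrightarrow> f e x \<in> \<real>)"
proof -
  define e0 where "e0 = complex_of_real (1 / (4 * \<alpha>^2))"
  define T where "T = ball (0::complex) 2"
  have T: "open T" "convex T" "\<And>x. x \<in> T \<Longrightarrow> - x \<in> T" by (auto simp: T_def)
  obtain C where C: "C > 0" "\<And>m. m < 4 \<Longrightarrow> sup_bounded 2 (clamped k m) C"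
    using clamped_bounded_common[of 2 k] by auto
  \<comment> \<open>The factor \<open>1 / (8 * C)\<close> yields contraction by 1/2:
    \<open>nonlin\<close> has four arguments, each moved by at most \<open>C * d\<close>.\<close>
  obtain \<rho>0 where \<rho>0: "\<rho>0 > 0"
    "\<And>e v p s t v' p' s' t'. norm (e - e0) + (norm v + norm p + norm s + norm t) < \<rho>0 \<Longrightarrow>
       norm (e - e0) + (norm v' + norm p' + norm s' + norm t') < \<rho>0 \<Longrightarrow>
       norm (nonlin \<alpha> e v p s t - nonlin \<alpha> e v' p' s' t')
         \<le> 1 / (8 * C) * (norm (v - v') + norm (p - p') + norm (s - s') + norm (t - t'))"
    using nonlin_lipschitz[of \<alpha> "1 / (8 * C)"] assms C(1) unfolding e0_def by auto
  \<comment> \<open>\<open>\<rho> \<le> \<alpha>\<close> keeps \<open>\<alpha> + v\<close> away from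
    0, and \<open>\<rho> \<le> 1\<close> does the same for \<open>1 + p * p\<close>.\<close>
  define \<rho> where "\<rho> = min \<rho>0 (min \<alpha> 1)"
  \<comment> \<open>Then \<open>v\<close> and its three derivatives are each at most
    \<open>\<rho> / 8\<close>, together \<open>\<rho> / 2\<close>; with \<open>\<rho> / 4\<close>
    for \<open>e\<close> the total stays below \<open>\<rho>0\<close>.\<close>
  define M where "M = \<rho> / (8 * C)"
  \<comment> \<open>\<open>\<alpha> * M / 4\<close> bounds the defect
    \<open>2 / \<alpha> * r\<close> of the cylinder by \<open>M / 2\<close>; the contraction adds at
    most another \<open>M / 2\<close>.\<close>
  define r where "r = min (\<rho> / 4) (\<alpha> * M / 4)"
  have \<rho>: "\<rho> > 0" "\<rho> \<le> \<rho>0" "\<rho> \<le> \<alpha>" "\<rho> \<le> 1"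
    using \<rho>0(1) assms by (auto simp: \<rho>_def)
  have M: "M > 0" "C * M = \<rho> / 8"
    using \<rho> C(1) by (auto simp: M_def)
  have r: "r > 0" "r \<le> \<rho> / 4" "2 / \<alpha> * r \<le> M / 2"
    using \<rho> M(1) assms by (auto simp: r_def field_simps min_def)
  define S where "S = ball e0 r"
  have S: "open S" "convex S" by (auto simp: S_def)
  define N where "N e v = nonlin \<alpha> e (v 0) (v 1) (v 2) (v 3)" for e and v :: "nat \<Rightarrow> complex"
  have N_lip: "norm (N e v - N e w) \<le> d / 2"
    if "e \<in> S" "\<And>m. m < 4 \<Longrightarrow> norm (v m) \<le> C * M" "\<And>m. m < 4 \<Longrightarrow> norm (w m) \<le> C * M"
      "\<And>m. m < 4 \<Longrightarrow> norm (v m - w m) \<le> C * d" for e v w d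
  proof -
    have "norm (e - e0) < \<rho> / 4"
      using that(1) r(2) by (simp add: S_def dist_norm norm_minus_commute)
    then have "norm (N e v - N e w) \<le> 1 / (8 * C) * (norm (v 0 - w 0) + norm (v 1 - w 1) + norm (v 2 - w 2) + norm (v 3 - w 3))"
      unfolding N_def
      using that(2)[of 0] that(2)[of 1] that(2)[of 2] that(2)[of 3] that(3)[of 0] that(3)[of 1] that(3)[of 2] that(3)[of 3]
        M \<rho> by (intro \<rho>0(2)) simp_all
    also have "\<dots> \<le> 1 / (8 * C) * (4 * (C * d))"
      using that(4)[of 0] that(4)[of 1] that(4)[of 2] that(4)[of 3] C(1) by (intro mult_left_mono) simp_all
    also have "\<dots> = d / 2" using C(1) by simp
    finally show ?thesis .
  qed
  have N0: "norm (N e (\<lambda>_. 0)) \<le> M / 2" if "e \<in> S" for e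
  proof -
    have "N e (\<lambda>_. 0) = - (2 / of_real \<alpha>) * (e - e0)"
      using assms nonlin_at_0[of \<alpha> e] by (simp add: N_def e0_def)
    then have "norm (N e (\<lambda>_. 0)) = 2 / \<alpha> * norm (e - e0)"
      using assms by (simp only: norm_mult norm_minus_cancel norm_divide) simp
    also have "\<dots> \<le> 2 / \<alpha> * r"
      using that assms by (intro mult_left_mono) (auto simp: S_def dist_norm norm_minus_commute)
    finally show ?thesis using r(3) by simp
  qed
  have N_bd: "norm (N e v) \<le> M" if "e \<in> S" "\<And>m. m < 4 \<Longrightarrow> norm (v m) \<le> C * M" for e v
  proof -
    have "norm (N e v - N e (\<lambda>_. 0)) \<le> M / 2"
      using that C(1) M(1) by (intro N_lip) auto
    with N0[OF that(1)] show ?thesis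
      using norm_triangle_ineq[of "N e v - N e (\<lambda>_. 0)" "N e (\<lambda>_. 0)"] by simp
  qed
  define G where "G f e x m = clamped k m (\<lambda>y. f (e, y)) x" for f :: "complex \<times> complex \<Rightarrow> complex" and e x m
  define \<Phi> where "\<Phi> f z = N (fst z) (G f (fst z) (snd z))" for f z
  have G_bd: "norm (G f e x m) \<le> C * M" if "admissible S T M f" "e \<in> S" "x \<in> T" "m < 4" for f e x m
    unfolding G_def
    by (rule sup_boundedD[OF C(2)[OF that(4)]])
       (use that in \<open>auto simp: admissible_def T_def sep_holomorphic_def\<close>)
  have G_sep: "sep_holomorphic (\<lambda>e x. G f e x m) S T" if "admissible S T M f" for f m
    unfolding G_def T_def
    by (rule sep_holomorphic_clamped[OF _ S]) (use that in \<open>auto simp: admissible_def T_def\<close>)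
  have "\<exists>f. admissible S T M f \<and> (\<forall>z\<in>S \<times> T. \<Phi> f z = f z)"
  proof (rule uniform_contraction_fixpoint[where ?d0.0 = M and ?f0.0 = "\<lambda>_. 0"])
    show "admissible S T M (\<lambda>_. 0)"
      using M(1) by (auto simp: admissible_def sep_holomorphic_const)
    show adm: "admissible S T M (\<Phi> f)" if f: "admissible S T M f" for f
      unfolding admissible_def
    proof (intro conjI ballI impI)
      show "sep_holomorphic (\<lambda>e x. \<Phi> f (e, x)) S T"
        unfolding \<Phi>_def N_def fst_conv snd_conv
      proof (rule sep_holomorphic_nonlin)
        fix e x assume ex: "e \<in> S" "x \<in> T"
        show "of_real \<alpha> + G f e x 0 \<noteq> 0"
        proof
          assume "of_real \<alpha> + G f e x 0 = 0"
          then have "norm (G f e x 0) = norm (- complex_of_real \<alpha>)"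
            by (simp add: add_eq_0_iff2)
          then show False using G_bd[OF f ex, of 0] M(2) \<rho> assms by simp
        qed
        show "1 + G f e x 1 * G f e x 1 \<noteq> 0"
        proof
          assume "1 + G f e x 1 * G f e x 1 = 0"
          then have "norm (G f e x 1 * G f e x 1) = norm (- (1::complex))"
            by (metis add_eq_0_iff)
          moreover have "norm (G f e x 1) * norm (G f e x 1) \<le> 1 / 8 * (1 / 8)"
            using G_bd[OF f ex, of 1] M(2) \<rho> by (intro mult_mono) auto
          ultimately show False by (simp add: norm_mult)
        qed
      qed (use G_sep[OF f] assms in auto)
      fix e x assume ex: "e \<in> S" "x \<in> T"
      show "norm (\<Phi> f (e, x)) \<le> M"
        unfolding \<Phi>_def using ex G_bd[OF f] by (intro N_bd) auto
      have par: "G f e (- x) m = (-1) ^ m * G f e x m" for m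
        unfolding G_def by (rule clamped_minus[where R = 2]) (use f ex in \<open>auto simp: admissible_def T_def\<close>)
      show "\<Phi> f (e, - x) = \<Phi> f (e, x)"
        using nonlin_even[of \<alpha> e "G f e x 0" "G f e x 1" "G f e x 2" "G f e x 3"]
        by (simp add: \<Phi>_def N_def par)
      show "\<Phi> f (e, x) \<in> \<real>" if "e \<in> \<real>" "x \<in> \<real>"
      proof -
        have "G f e x m \<in> \<real>" for m
          unfolding G_def by (rule clamped_real[where R = 2]) (use f ex that in \<open>auto simp: admissible_def T_def\<close>)
        then show ?thesis
          unfolding \<Phi>_def N_def using that by (auto intro: nonlin_real)
      qed
    qed
    show "norm (\<Phi> (\<lambda>_. 0) z - 0) \<le> M" if "z \<in> S \<times> T" for z
      using N_bd[of "fst z" "G (\<lambda>_. 0) (fst z) (snd z)"] G_bd[of "\<lambda>_. 0" "fst z" "snd z"] that M(1)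
      by (auto simp: \<Phi>_def admissible_def sep_holomorphic_const)
    show "norm (\<Phi> f z - \<Phi> g z) \<le> d / 2"
      if fg: "admissible S T M f" "admissible S T M g" and d: "\<And>y. y \<in> S \<times> T \<Longrightarrow> norm (f y - g y) \<le> d"
        and z: "z \<in> S \<times> T" for f g d z
      unfolding \<Phi>_def
    proof (rule N_lip)
      show zS: "fst z \<in> S" using z by auto
      show "norm (G f (fst z) (snd z) m) \<le> C * M" "norm (G g (fst z) (snd z) m) \<le> C * M" if "m < 4" for m
        using G_bd fg z that by auto
      have hol: "(\<lambda>y. f (fst z, y)) holomorphic_on ball 0 2" "(\<lambda>y. g (fst z, y)) holomorphic_on ball 0 2"
        using fg zS by (auto simp: admissible_def sep_holomorphic_def T_def)
      have zT: "snd z \<in> ball 0 2" using z by (auto simp: T_def)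
      show "norm (G f (fst z) (snd z) m - G g (fst z) (snd z) m) \<le> C * d" if "m < 4" for m
      proof -
        have "norm (clamped k m (\<lambda>y. f (fst z, y) - g (fst z, y)) (snd z)) \<le> C * d"
          by (rule sup_boundedD[OF C(2)[OF that] _ _ zT]) (use d zS hol in \<open>auto simp: T_def intro!: holomorphic_intros\<close>)
        then show ?thesis
          using clamped_diff[OF hol zT] by (simp add: G_def)
      qed
    qed
    show "admissible S T M f" if "\<And>n. admissible S T M (F n)" "uniform_limit (S \<times> T) F f sequentially" for F f
      by (rule admissible_uniform_limit[OF that S(1) T(1) T(3)])
  qed
  then obtain f where f: "admissible S T M f" "\<And>e x. e \<in> S \<Longrightarrow> x \<in> T \<Longrightarrow> \<Phi> f (e, x) = f (e, x)"
    by blast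
  show thesis
  proof (rule that[of r "\<lambda>e x. f (e, x)"], goal_cases)
    case 2
    then show ?case using f(1) by (simp add: admissible_def S_def T_def e0_def)
  next
    case (3 e x)
    then have ex: "e \<in> S" "x \<in> T" by (simp_all add: S_def T_def e0_def)
    have "norm (G f e x 0) < \<alpha>"
      using G_bd[OF f(1) ex, of 0] M(2) \<rho> assms by simp
    moreover have "f (e, x) = N e (G f e x)"
      using f(2)[OF ex] by (simp add: \<Phi>_def)
    moreover have "f (e, - x) = f (e, x) \<and> (e \<in> \<real> \<longrightarrow> x \<in> \<real> \<longrightarrow> f (e, x) \<in> \<real>)"
      using f(1) ex unfolding admissible_def by blast
    ultimately show ?case
      unfolding N_def G_def by blast
  qed (rule r)
qed

section \<open>Return to real variables and the boundary value problem\<close>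

lemma helfrich_rhs_of_real:
  "helfrich_rhs (of_real e) (of_real u) (of_real p) (of_real s) (of_real t) = complex_of_real (helfrich_rhs e u p s t)"
  by (simp add: helfrich_rhs_def Let_def)

theorem theorem4p1:
  fixes \<alpha> :: real
  assumes "\<alpha> > 0"
  shows "\<exists>\<delta>>0. \<exists>U :: real \<Rightarrow> real \<Rightarrow> real.
     smooth_family_on {1/(4*\<alpha>^2) - \<delta> <..< 1/(4*\<alpha>^2) + \<delta>} {-1..1} U \<and>
     (\<forall>\<epsilon>\<in>{1/(4*\<alpha>^2) - \<delta> <..< 1/(4*\<alpha>^2) + \<delta>}.
        in_N \<alpha> (U \<epsilon>) \<and> Cinf_on {-1..1} (U \<epsilon>) \<and>
        (\<forall>x\<in>{-1<..<1}. helfrich_eq \<epsilon> (U \<epsilon>) x))"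
proof -
  \<comment> \<open>Chosen so that \<open>4 k^4 = 1/\<alpha>^4\<close>, the coefficient in the
    linearised equation.\<close>
  define k where "k = 1 / (\<alpha> * sqrt 2)"
  have "k > 0" using assms by (simp add: k_def)
  have k4: "4 * k^4 = 1 / \<alpha>^4"
  proof -
    have "sqrt 2 ^ 4 = (sqrt 2 ^ 2) ^ 2" by (simp only: power_mult[symmetric]) simp
    then show ?thesis by (simp add: k_def power_divide power_mult_distrib)
  qed
  obtain \<delta> f where "\<delta> > 0" and f: "sep_holomorphic f (ball (of_real (1 / (4 * \<alpha>^2))) \<delta>) (ball 0 2)"
    and sol: "\<And>e x. e \<in> ball (of_real (1 / (4 * \<alpha>^2))) \<delta> \<Longrightarrow> x \<in> ball 0 2 \<Longrightarrow> norm (clamped k 0 (f e) x) < \<alpha> \<and>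
       f e x = nonlin \<alpha> e (clamped k 0 (f e) x) (clamped k 1 (f e) x) (clamped k 2 (f e) x) (clamped k 3 (f e) x) \<and>
       f e (- x) = f e x \<and> (e \<in> \<real> \<longrightarrow> x \<in> \<real> \<longrightarrow> f e x \<in> \<real>)"
    using holomorphic_solution_family[OF assms, of k] by blast
  let ?I = "{1/(4*\<alpha>^2) - \<delta> <..< 1/(4*\<alpha>^2) + \<delta>}"
  \<comment> \<open>Smooth in \<open>x\<close> on all of \<open>(-2, 2)\<close>, so the derivatives
    at the endpoints and every \<open>deriv\<close> in the interior come from a full
    neighbourhood.\<close>
  define U where "U e x = Re (of_real \<alpha> + clamped k 0 (f (of_real e)) (of_real x))" for e x :: real
  have I: "complex_of_real e \<in> ball (of_real (1 / (4 * \<alpha>^2))) \<delta>" if "e \<in> ?I" for e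
    using that by (auto simp: dist_of_real dist_real_def simp del: of_real_divide of_real_mult)
  have smooth: "smooth_family_on ?I {-1..1} U"
    unfolding U_def[abs_def]
  proof (rule smooth_family_on_Re)
    show "sep_holomorphic (\<lambda>e x. of_real \<alpha> + clamped k 0 (f e) x) (ball (of_real (1 / (4 * \<alpha>^2))) \<delta>) (ball 0 2)"
      by (intro sep_holomorphic_add sep_holomorphic_const sep_holomorphic_clamped[OF f]) auto
    show "complex_of_real ` ?I \<subseteq> ball (of_real (1 / (4 * \<alpha>^2))) \<delta>" using I by blast
  qed auto
  have "in_N \<alpha> (U e) \<and> (\<forall>x\<in>{-1<..<1}. helfrich_eq e (U e) x)" if e: "e \<in> ?I" for e
  proof -
    define g where "g = f (of_real e)"
    define v where "v m x = clamped k m g (complex_of_real x)" for m x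
    have g: "g holomorphic_on ball 0 2"
      unfolding g_def by (rule sep_holomorphicD(3)[OF f I[OF e]])
    have B: "complex_of_real x \<in> ball 0 2 \<longleftrightarrow> x \<in> {-2<..<2}" for x
      by auto
    have gx: "norm (v 0 x) < \<alpha>" "g (of_real x) = nonlin \<alpha> (of_real e) (v 0 x) (v 1 x) (v 2 x) (v 3 x)"
      if "x \<in> {-2<..<2}" for x
      using sol[OF I[OF e], of "of_real x"] that B unfolding g_def[symmetric] v_def by blast+
    have g_sym: "g (- y) = g y" "y \<in> \<real> \<Longrightarrow> g y \<in> \<real>" if "y \<in> ball 0 2" for y
      unfolding g_def using sol[OF I[OF e] that] Reals_of_real[of e] by blast+
    \<comment> \<open>Realness lets \<open>Re\<close> be moved inside the rational function
      \<open>helfrich_rhs\<close>.\<close>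
    have real: "v m x = of_real (Re (v m x))" if "x \<in> {-2<..<2}" for m x
    proof -
      have "v m x \<in> \<real>"
        unfolding v_def by (rule clamped_real[where R = 2]) (use g_sym that B in auto)
      then show ?thesis by (simp add: of_real_Re)
    qed
    have par: "v m (- x) = (-1) ^ m * v m x" if "x \<in> {-2<..<2}" for m x
      unfolding v_def of_real_minus
      by (rule clamped_minus[where R = 2]) (use g_sym that B in auto)
    have U: "U e = (\<lambda>x. \<alpha> + Re (v 0 x))"
      by (simp add: U_def v_def g_def fun_eq_iff)
    have dv: "((\<lambda>x. Re (v m x)) has_real_derivative Re (v (m + 1) x)) (at x within A)"
      if "m < 3" "x \<in> {-2<..<2}" for m x A
      unfolding v_def by (intro has_real_derivative_Re_of_real clamped_has_field_derivative[OF g]) (use that B in auto)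
    have dU: "(U e has_real_derivative Re (v 1 x)) (at x within A)" if "x \<in> {-2<..<2}" for x A
      unfolding U using DERIV_add[OF DERIV_const dv[of 0 x A]] that by simp
    have d3: "((\<lambda>x. Re (v 3 x)) has_real_derivative helfrich_rhs e (U e x) (Re (v 1 x)) (Re (v 2 x)) (Re (v 3 x))) (at x)"
      if x: "x \<in> {-2<..<2}" for x
    proof -
      \<comment> \<open>The summand \<open>v/\<alpha>^4\<close> of \<open>nonlin\<close> cancels
        against \<open>4 k^4 v\<close>, which leaves the explicit equation for
        \<open>u''''\<close>.\<close>
      have "g (of_real x) - of_real (4 * k^4) * v 0 x = helfrich_rhs (of_real e) (of_real \<alpha> + v 0 x) (v 1 x) (v 2 x) (v 3 x)"
        unfolding gx(2)[OF x] nonlin_def k4 by simp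
      also have "\<dots> = helfrich_rhs (of_real e) (of_real (U e x)) (of_real (Re (v 1 x))) (of_real (Re (v 2 x))) (of_real (Re (v 3 x)))"
        using real[OF x] by (simp add: U)
      finally have "Re (g (of_real x) - of_real (4 * k^4) * v 0 x) = helfrich_rhs e (U e x) (Re (v 1 x)) (Re (v 2 x)) (Re (v 3 x))"
        unfolding helfrich_rhs_of_real by simp
      moreover have "((\<lambda>x. Re (v 3 x)) has_real_derivative Re (g (of_real x) - of_real (4 * k^4) * v 0 x)) (at x)"
        unfolding v_def using \<open>k > 0\<close>
        by (intro has_real_derivative_Re_of_real clamped_has_field_derivative(2)[OF g]) (use x B in auto)
      ultimately show ?thesis by simp
    qed
    have pos: "U e x > 0" if "x \<in> {-2<..<2}" for x
      using gx(1)[OF that] abs_Re_le_cmod[of "v 0 x"] by (simp add: U)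
    have v1: "v 0 1 = 0" "v 1 1 = 0"
      using clamped_boundary[OF \<open>k > 0\<close>] by (simp_all add: v_def)
    then have v2: "v 0 (-1) = 0" "v 1 (-1) = 0"
      using par[of 1 0] par[of 1 1] by simp_all
    have "in_N \<alpha> (U e)"
      unfolding in_N_def
      using pos v1 v2 par[of _ 0] dU[of 1 "{-1..1}"] dU[of "-1" "{-1..1}"] by (auto simp: U)
    moreover have "helfrich_eq e (U e) x" if "x \<in> {-1<..<1}" for x
    proof (rule helfrich_eq_if_ode)
      show "open {-2<..<2::real}" by simp
      show "(U e has_real_derivative Re (v 1 x)) (at x)" if "x \<in> {-2<..<2}" for x
        by (rule dU[OF that])
      show "((\<lambda>x. Re (v 1 x)) has_real_derivative Re (v 2 x)) (at x)" if "x \<in> {-2<..<2}" for x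
        using dv[of 1 x] that by (simp add: numeral_2_eq_2)
      show "((\<lambda>x. Re (v 2 x)) has_real_derivative Re (v 3 x)) (at x)" if "x \<in> {-2<..<2}" for x
        using dv[of 2 x] that by (simp add: eval_nat_numeral)
    qed (use d3 pos that in auto)
    ultimately show ?thesis by blast
  qed
  then show ?thesis
    using \<open>\<delta> > 0\<close> smooth Cinf_on_smooth_family[OF smooth] by blast
qed

end
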